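(* Let $(d_k)_{k\ge1}$ and $(N_k)_{k\ge1}$ be sequences of natural numbers such that $(d_k)$ is lacunary, $N_k\mid N_{k+1}$ and $N_k<N_{k+1}$ for all $k$. Then the following conditions are equivalent: (i) there exist constants $a,C$ such that $d_k\le CN_{k+a}$ for all $k$; (ii) there is a constant $c>0$ such that for every $n$ and all trigonometric polynomials $f_1,\dots,f_n\in H^1(\mathbb{T})$ with $\deg f_k\le d_k$, \[\mathbb{E}\Big(\sum_{k=1}^n|f_k|^2\Big)^{1/2}\ge c\,\mathbb{E}\Big(\sum_{k=1}^n|\mathbb{E}^*_{N_k}f_k|^2\Big)^{1/2};\] (iii) there is a constant $c>0$ such that for every $n$ and all trigonometric polynomials $f_1,\dots,f_n\in H^1(\mathbb{T})$ with $\deg f_k\le d_k$, \[\big\|(f_k)_{k=1}^n\big\|_{L^1(\ell^2)}\ge c\,\big\|(\mathbb{E}^*_{N_k}f_k)_{k=1}^n\big\|_{\mathrm{ind}}.\]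
   Context: $\mathbb{T}=\mathbb{R}/2\pi\mathbb{Z}$ with normalized Lebesgue measure $\mu$, and $\mathbb{E}$ denotes integration against $\mu$. $H^1(\mathbb{T})$ is the closed span in $L^1(\mathbb{T})$ of $e^{ijt}$, $j\ge0$. A sequence $(d_k)$ of positive integers is lacunary if $\inf_k d_{k+1}/d_k>1$. For a positive integer $N$, $\mathcal{F}^*_N$ is the $\sigma$-algebra of subsets of $\mathbb{T}$ whose indicator functions are $\frac{2\pi}{N}$-periodic, and $\mathbb{E}^*_N f(t)=\frac1N\sum_{j=0}^{N-1}f(t+\frac{2\pi j}{N})$ is the conditional expectation onto it. For functions $g_1,\dots,g_n$ on $\mathbb{T}$: $\|(g_k)\|_{L^1(\ell^2)}=\mathbb{E}(\sum_k|g_k|^2)^{1/2}$ and $\|(g_k)\|_{\mathrm{ind}}=\int_{\mathbb{T}^n}(\sum_k|g_k(t_k)|^2)^{1/2}\,d\mu(t_1)\cdots d\mu(t_n)$. *)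

theory Defs
  imports "HOL-Probability.Probability"
begin

definition torus :: "real measure" where
  "torus = uniform_measure lborel {0..2*pi}"

definition torus_expect :: "(real \<Rightarrow> real) \<Rightarrow> real" where
  "torus_expect g = integral\<^sup>L torus g"

definition analytic_trig_poly :: "nat \<Rightarrow> (real \<Rightarrow> complex) \<Rightarrow> bool" where
  "analytic_trig_poly d f \<longleftrightarrow>
     (\<exists>a :: nat \<Rightarrow> complex. f = (\<lambda>t. \<Sum>j\<le>d. a j * exp (\<i> * of_nat j * of_real t)))"

text \<open>Conditional expectation onto the sigma-algebra of 2pi/N-periodic sets.\<close>
definition cond_exp_star :: "nat \<Rightarrow> (real \<Rightarrow> complex) \<Rightarrow> real \<Rightarrow> complex" where
  "cond_exp_star N f t = (1 / of_nat N) * (\<Sum>j<N. f (t + 2 * pi * real j / real N))"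

definition lacunary :: "(nat \<Rightarrow> nat) \<Rightarrow> bool" where
  "lacunary d \<longleftrightarrow> (\<exists>q>1. \<forall>k\<ge>1. real (d (Suc k)) \<ge> q * real (d k))"

definition L1_l2_norm :: "nat \<Rightarrow> (nat \<Rightarrow> real \<Rightarrow> complex) \<Rightarrow> real" where
  "L1_l2_norm n g = torus_expect (\<lambda>t. sqrt (\<Sum>k\<in>{1..n}. (cmod (g k t))\<^sup>2))"

definition ind_norm :: "nat \<Rightarrow> (nat \<Rightarrow> real \<Rightarrow> complex) \<Rightarrow> real" where
  "ind_norm n g = integral\<^sup>L (PiM {1..n} (\<lambda>_. torus))
      (\<lambda>x. sqrt (\<Sum>k\<in>{1..n}. (cmod (g k (x k)))\<^sup>2))"

end

theory Submission
  imports Defs "HOL-Computational_Algebra.Polynomial" "HOL-Library.Real_Mod"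
begin

text \<open>
  Both norms on the right are expectations of the square function of \<open>g k (X k)\<close>, where \<open>g k\<close> is the
  mean of \<open>f k\<close> over the rotations by multiples of \<open>2 * pi / N k\<close> and the \<open>X k\<close> are uniform variables:
  identical ones for (ii), independent ones for (iii). The joint law of the \<open>X k\<close> plays no role.

  \<^emph>\<open>Sufficiency of (i).\<close> After splitting the indices into residue classes one may assume
  \<open>d k \<le> C * N l\<close> for \<open>k < l\<close>. Write \<open>A k\<close> for the square function of the \<open>f l\<close> with \<open>l \<le> k\<close>.
  Convexity of the Euclidean norm gives \<open>E (A k) \<ge> E (sqrt (B\<^sup>2 + |g k|\<^sup>2))\<close>, where \<open>B\<close> is the mean of
  \<open>A (k - 1)\<close> over the same rotations; moreover \<open>E B = E (A (k - 1))\<close>, and \<open>B\<close> is bounded pointwise by a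
  constant times \<open>E (A (k - 1))\<close>, because the degrees involved are \<open>O(N k)\<close>. As
  \<open>s \<mapsto> sqrt (s\<^sup>2 + x\<^sup>2) - s\<close> is decreasing, with \<open>R = M * E (A n)\<close> these inequalities telescope to
  \<open>\<Sum>k. E (sqrt (R\<^sup>2 + |g k|\<^sup>2) - R) \<le> E (A n)\<close>. The left side depends only on the law of each single
  \<open>g k (X k)\<close>, and \<open>sqrt (\<Sum>k. x k\<^sup>2)\<close> is at most \<open>R + (\<Sum>k. sqrt (R\<^sup>2 + x k\<^sup>2) - R)\<close>.

  \<^emph>\<open>Necessity of (i).\<close> If (i) fails, there are arbitrarily long windows of indices on which all
  \<open>d l\<close> exceed \<open>4 * L\<close>, where \<open>L\<close> is the value of \<open>N\<close> at the end of the window. Let all \<open>f l\<close> with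
  \<open>l\<close> in a sparse subset of \<open>b\<close> indices equal the fourth power of the modulus of a Dirichlet sum of
  length \<open>L\<close>, modulated to be analytic. The left side is then \<open>sqrt b * E |f|\<close>, while the means are so
  concentrated and at such different scales that \<open>E (sqrt (|g k (X k)| * |g l (X l)|))\<close>, at most the
  product of an \<open>L\<^sup>1\<close> and a supremum norm, decays geometrically in \<open>|k - l|\<close>; this makes the right side
  at least \<open>b / 2 * E |f|\<close>.
\<close>

section \<open>Integration over the torus\<close>

lemma sets_torus [simp, measurable_cong]: "sets torus = sets borel"
  by (simp add: torus_def)

lemma prob_space_torus: "prob_space torus"
  unfolding torus_def by (rule prob_space_uniform_measure) auto

lemma borel_measurable_torus_continuous:
  fixes g :: "real \<Rightarrow> 'a::topological_space"
  assumes "continuous_on UNIV g"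
  shows "g \<in> borel_measurable torus"
  using assms by (simp add: borel_measurable_continuous_onI measurable_cong_sets[OF sets_torus refl])

lemma integrable_torus_continuous:
  fixes g :: "real \<Rightarrow> 'a::{banach, second_countable_topology}"
  assumes "continuous_on UNIV g"
  shows "integrable torus g"
proof -
  interpret prob_space torus by (rule prob_space_torus)
  have "compact (g ` {0..2*pi})"
    using assms by (intro compact_continuous_image) (auto intro: continuous_on_subset)
  then obtain b where "\<And>x. x \<in> {0..2*pi} \<Longrightarrow> norm (g x) \<le> b"
    by (meson bounded_iff compact_imp_bounded imageI)
  then have "AE x in torus. norm (g x) \<le> b"
    unfolding torus_def by (intro AE_uniform_measureI) auto
  then show ?thesis
    using borel_measurable_torus_continuous[OF assms] by (rule integrable_const_bound)
qed

lemma torus_eq_density: "torus = density lborel (\<lambda>x. ennreal (indicator {0..2*pi} x / (2*pi)))"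
  unfolding torus_def uniform_measure_def
  by (intro density_cong) (auto simp: divide_ennreal[symmetric] ennreal_mult' split: split_indicator)

lemma integral_torus_eq_integral:
  fixes g :: "real \<Rightarrow> 'a::euclidean_space"
  assumes "continuous_on UNIV g"
  shows "integral\<^sup>L torus g = (1 / (2*pi)) *\<^sub>R integral {0..2*pi} g"
proof -
  have "set_integrable lborel {0..2*pi} g"
    unfolding set_integrable_def
    by (rule borel_integrable_compact) (use assms in \<open>auto intro: continuous_on_subset\<close>)
  then have "(LINT x:{0..2*pi}|lborel. g x) = integral {0..2*pi} g"
    by (rule set_borel_integral_eq_integral)
  moreover have "integral\<^sup>L torus g = (\<integral>x. (indicator {0..2*pi} x / (2*pi)) *\<^sub>R g x \<partial>lborel)"
    unfolding torus_eq_density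
    by (rule integral_density) (use assms in \<open>auto intro: borel_measurable_continuous_onI\<close>)
  moreover have "\<dots> = (1 / (2*pi)) *\<^sub>R (LINT x:{0..2*pi}|lborel. g x)"
    by (simp add: set_lebesgue_integral_def flip: integral_scaleR_right)
  ultimately show ?thesis by simp
qed

lemma integral_torus_shift:
  fixes g :: "real \<Rightarrow> 'a::euclidean_space"
  assumes cont: "continuous_on UNIV g" and periodic: "\<And>t. g (t + 2*pi) = g t"
  shows "(\<integral>t. g (t + c) \<partial>torus) = integral\<^sup>L torus g"
proof -
  interpret periodic_fun_simple g "2*pi" by standard (rule periodic)
  define r where "r = c rmod (2*pi)"
  have r: "0 \<le> r" "r \<le> 2*pi"
    by (simp_all add: r_def rmod_nonneg rmod_le)
  have shift_r: "g (t + c) = g (t + r)" for t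
    using plus_of_int[of "t + r" "\<lfloor>c / (2*pi)\<rfloor>"] by (simp add: r_def rmod_def algebra_simps)
  have integrable: "g integrable_on {a..b}" for a b
    by (rule integrable_continuous_real) (use cont in \<open>auto intro: continuous_on_subset\<close>)
  have "integral {0..2*pi} (\<lambda>t. g (t + r)) = integral {r..2*pi+r} g"
    using integral_shift_real_ivl[of r r "2*pi + r" g] by simp
  also have "\<dots> = integral {r..2*pi} g + integral {2*pi..2*pi+r} g"
    using r integrable by (intro Henstock_Kurzweil_Integration.integral_combine[symmetric]) auto
  also have "integral {2*pi..2*pi+r} g = integral {0..r} g"
    using integral_shift_real_ivl[of "2*pi" "2*pi" "2*pi + r" g] periodic by simp
  also have "integral {r..2*pi} g + integral {0..r} g = integral {0..2*pi} g"
    using r integrable Henstock_Kurzweil_Integration.integral_combine[of 0 r "2*pi" g]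
    by (simp add: add.commute)
  finally have "integral {0..2*pi} (\<lambda>t. g (t + r)) = integral {0..2*pi} g" .
  moreover have "continuous_on UNIV (\<lambda>t. g (t + r))"
    by (intro continuous_on_compose2[OF cont] continuous_intros) auto
  ultimately show ?thesis
    by (simp add: shift_r integral_torus_eq_integral cont)
qed

lemma cis_of_int_mult_periodic: "cis (of_int k * (t + 2*pi)) = cis (of_int k * t)"
proof -
  have "cis (of_int k * (2*pi)) = 1"
    using cis_multiple_2pi[of "of_int k"] by (simp add: mult.commute)
  then show ?thesis by (simp add: distrib_left flip: cis_mult)
qed

lemma integral_torus_cis:
  fixes k :: int
  shows "(\<integral>t. cis (of_int k * t) \<partial>torus) = (if k = 0 then 1 else 0)"
proof (cases "k = 0")
  case True
  then show ?thesis
    using prob_space.prob_space[OF prob_space_torus] by simp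
next
  case False
  have "(\<integral>t. cis (of_int k * t) \<partial>torus) = (\<integral>t. cis (of_int k * (t + pi / of_int k)) \<partial>torus)"
    by (rule integral_torus_shift[symmetric])
      (auto intro!: continuous_intros simp: cis_of_int_mult_periodic)
  also have "\<dots> = - (\<integral>t. cis (of_int k * t) \<partial>torus)"
    using False by (simp add: distrib_left flip: minus_cis)
  finally show ?thesis using False by simp
qed

lemma integral_trig_sum_mult_cnj:
  fixes a b :: "nat \<Rightarrow> complex"
  assumes "finite A" and "finite B"
  shows "(\<integral>t. (\<Sum>i\<in>A. a i * cis (real i * t)) * cnj (\<Sum>j\<in>B. b j * cis (real j * t)) \<partial>torus)
    = (\<Sum>i\<in>A \<inter> B. a i * cnj (b i))"
proof -
  let ?e = "\<lambda>i j t. a i * cnj (b j) * cis (of_int (int i - int j) * t)"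
  have integrable: "integrable torus (?e i j)" for i j
    by (intro integrable_torus_continuous continuous_intros)
  have "(\<integral>t. (\<Sum>i\<in>A. a i * cis (real i * t)) * cnj (\<Sum>j\<in>B. b j * cis (real j * t)) \<partial>torus)
      = (\<integral>t. (\<Sum>i\<in>A. \<Sum>j\<in>B. ?e i j t) \<partial>torus)"
    by (simp add: sum_product cis_cnj cis_mult algebra_simps)
  also have "\<dots> = (\<Sum>i\<in>A. \<integral>t. (\<Sum>j\<in>B. ?e i j t) \<partial>torus)"
    by (intro Bochner_Integration.integral_sum Bochner_Integration.integrable_sum integrable)
  also have "\<dots> = (\<Sum>i\<in>A. \<Sum>j\<in>B. integral\<^sup>L torus (?e i j))"
    by (intro sum.cong refl Bochner_Integration.integral_sum integrable)
  also have "\<dots> = (\<Sum>i\<in>A. \<Sum>j\<in>B. if i = j then a i * cnj (b i) else 0)"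
    by (intro sum.cong refl) (simp add: integral_torus_cis del: of_int_diff)
  also have "\<dots> = (\<Sum>i\<in>A \<inter> B. a i * cnj (b i))"
    using assms by (simp add: sum.inter_restrict)
  finally show ?thesis .
qed

lemma integral_norm_trig_sum_square:
  fixes a :: "nat \<Rightarrow> complex"
  assumes "finite A"
  shows "(\<integral>t. (cmod (\<Sum>j\<in>A. a j * cis (real j * t)))\<^sup>2 \<partial>torus) = (\<Sum>j\<in>A. (cmod (a j))\<^sup>2)"
proof -
  let ?f = "\<lambda>t. \<Sum>j\<in>A. a j * cis (real j * t)"
  have "complex_of_real (\<integral>t. (cmod (?f t))\<^sup>2 \<partial>torus) = (\<integral>t. ?f t * cnj (?f t) \<partial>torus)"
    by (simp only: complex_norm_square integral_complex_of_real[symmetric])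
  also have "\<dots> = complex_of_real (\<Sum>j\<in>A. (cmod (a j))\<^sup>2)"
    using assms by (simp only: integral_trig_sum_mult_cnj Int_absorb of_real_sum complex_norm_square)
  finally show ?thesis by (simp only: of_real_eq_iff)
qed

section \<open>Analytic trigonometric polynomials\<close>

lemma analytic_trig_poly_cis:
  "analytic_trig_poly d f \<longleftrightarrow> (\<exists>a. f = (\<lambda>t. \<Sum>j\<le>d. a j * cis (real j * t)))"
  unfolding analytic_trig_poly_def by (simp add: cis_conv_exp mult.assoc)

lemma analytic_trig_poly_continuous: "analytic_trig_poly d f \<Longrightarrow> continuous_on UNIV f"
  unfolding analytic_trig_poly_cis by (auto intro!: continuous_intros)

lemma analytic_trig_poly_periodic: "analytic_trig_poly d f \<Longrightarrow> f (t + 2*pi) = f t"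
  unfolding analytic_trig_poly_cis using cis_of_int_mult_periodic[of "int _"] by auto

lemma analytic_trig_poly_iff_poly:
  "analytic_trig_poly d f \<longleftrightarrow> (\<exists>p. degree p \<le> d \<and> f = (\<lambda>t. poly p (cis t)))"
proof
  assume "analytic_trig_poly d f"
  then obtain a where f: "f = (\<lambda>t. \<Sum>j\<le>d. a j * cis (real j * t))"
    by (auto simp: analytic_trig_poly_cis)
  have "degree (\<Sum>j\<le>d. monom (a j) j) \<le> d"
    by (intro degree_sum_le) (auto intro: order_trans[OF degree_monom_le])
  moreover have "f = (\<lambda>t. poly (\<Sum>j\<le>d. monom (a j) j) (cis t))"
    by (simp add: f poly_sum poly_monom Complex.DeMoivre)
  ultimately show "\<exists>p. degree p \<le> d \<and> f = (\<lambda>t. poly p (cis t))" by blast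
next
  assume "\<exists>p. degree p \<le> d \<and> f = (\<lambda>t. poly p (cis t))"
  then obtain p where degree: "degree p \<le> d" and f: "f = (\<lambda>t. poly p (cis t))" by blast
  have "f = (\<lambda>t. \<Sum>j\<le>d. coeff p j * cis (real j * t))"
    unfolding f by (subst poly_as_sum_of_monoms'[OF degree, symmetric])
      (simp add: poly_sum poly_monom Complex.DeMoivre)
  then show "analytic_trig_poly d f"
    by (auto simp: analytic_trig_poly_cis)
qed

lemma analytic_trig_poly_0: "analytic_trig_poly d (\<lambda>_. 0)"
  unfolding analytic_trig_poly_iff_poly by (rule exI[of _ 0]) simp

lemma analytic_trig_poly_mono: "analytic_trig_poly d f \<Longrightarrow> d \<le> e \<Longrightarrow> analytic_trig_poly e f"
  unfolding analytic_trig_poly_iff_poly by (blast intro: order_trans)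

lemma analytic_trig_poly_mult:
  assumes "analytic_trig_poly d f" and "analytic_trig_poly e g"
  shows "analytic_trig_poly (d + e) (\<lambda>t. f t * g t)"
proof -
  obtain p q where "degree p \<le> d" "f = (\<lambda>t. poly p (cis t))"
    and "degree q \<le> e" "g = (\<lambda>t. poly q (cis t))"
    using assms by (auto simp: analytic_trig_poly_iff_poly)
  then show ?thesis
    unfolding analytic_trig_poly_iff_poly
    by (intro exI[of _ "p * q"]) (auto intro: order_trans[OF degree_mult_le add_mono])
qed

lemma analytic_trig_poly_reflect:
  assumes "analytic_trig_poly d f"
  shows "analytic_trig_poly d (\<lambda>t. cis (real d * t) * cnj (f t))"
proof -
  obtain a where f: "f = (\<lambda>t. \<Sum>j\<le>d. a j * cis (real j * t))"
    using assms by (auto simp: analytic_trig_poly_cis)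
  have "cis (real d * t) * cnj (f t) = (\<Sum>j\<le>d. cnj (a (d - j)) * cis (real j * t))" for t
  proof -
    have "cis (real d * t) * cnj (f t) = (\<Sum>j\<le>d. cnj (a j) * cis (real (d - j) * t))"
      by (simp add: f sum_distrib_left cis_cnj cis_mult of_nat_diff algebra_simps)
    also have "\<dots> = (\<Sum>j\<le>d. cnj (a (d - j)) * cis (real j * t))"
      by (rule sum.reindex_bij_witness[where i = "\<lambda>j. d - j" and j = "\<lambda>j. d - j"]) auto
    finally show ?thesis .
  qed
  then show ?thesis
    by (auto simp: analytic_trig_poly_cis)
qed

lemma norm_analytic_trig_poly_square_le:
  assumes "analytic_trig_poly d f"
  shows "(cmod (f t))\<^sup>2 \<le> (real d + 1) * (\<integral>s. (cmod (f s))\<^sup>2 \<partial>torus)"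
proof -
  obtain a where f: "f = (\<lambda>t. \<Sum>j\<le>d. a j * cis (real j * t))"
    using assms by (auto simp: analytic_trig_poly_cis)
  have "cmod (f t) \<le> (\<Sum>j\<le>d. 1 * cmod (a j))"
    unfolding f by (rule sum_norm_le) (simp add: norm_mult)
  then have "(cmod (f t))\<^sup>2 \<le> (\<Sum>j\<le>d. 1 * cmod (a j))\<^sup>2"
    by (rule power_mono) simp
  also have "\<dots> \<le> (\<Sum>j\<le>d. 1\<^sup>2) * (\<Sum>j\<le>d. (cmod (a j))\<^sup>2)"
    by (rule Cauchy_Schwarz_ineq_sum)
  also have "(\<Sum>j\<le>d. (cmod (a j))\<^sup>2) = (\<integral>s. (cmod (f s))\<^sup>2 \<partial>torus)"
    by (simp add: f integral_norm_trig_sum_square)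
  finally show ?thesis
    by (simp add: add.commute)
qed

section \<open>Means over rotations\<close>

definition rotation_mean :: "nat \<Rightarrow> (real \<Rightarrow> 'a::real_vector) \<Rightarrow> real \<Rightarrow> 'a" where
  "rotation_mean N h t = (1 / real N) *\<^sub>R (\<Sum>j<N. h (t + 2 * pi * real j / real N))"

lemma cond_exp_star_eq_rotation_mean: "cond_exp_star N f = rotation_mean N f"
  by (simp add: fun_eq_iff cond_exp_star_def rotation_mean_def scaleR_conv_of_real)

lemma continuous_on_rotation_mean:
  fixes h :: "real \<Rightarrow> 'a::real_normed_vector"
  assumes "continuous_on UNIV h"
  shows "continuous_on UNIV (rotation_mean N h)"
  unfolding rotation_mean_def
  by (intro continuous_intros continuous_on_compose2[OF assms]) auto

lemma rotation_mean_nonneg: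
  fixes h :: "real \<Rightarrow> real"
  assumes "\<And>t. h t \<ge> 0"
  shows "rotation_mean N h t \<ge> 0"
  unfolding rotation_mean_def using assms by (simp add: sum_nonneg)

lemma rotation_mean_mono:
  fixes g h :: "real \<Rightarrow> real"
  assumes "\<And>t. g t \<le> h t"
  shows "rotation_mean N g t \<le> rotation_mean N h t"
  unfolding rotation_mean_def using assms by (intro scaleR_left_mono sum_mono) auto

lemma norm_rotation_mean_le:
  fixes h :: "real \<Rightarrow> 'a::real_normed_vector"
  shows "norm (rotation_mean N h t) \<le> rotation_mean N (\<lambda>t. norm (h t)) t"
  unfolding rotation_mean_def norm_scaleR by (auto intro!: divide_right_mono norm_sum)

lemma sqrt_rotation_mean_square_le:
  assumes "\<And>t. h t \<ge> 0"
  shows "sqrt (rotation_mean N (\<lambda>t. (h t)\<^sup>2) t) \<le> sqrt (real N) * rotation_mean N h t"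
proof (cases "N = 0")
  case True
  then show ?thesis by (simp add: rotation_mean_def)
next
  case False
  let ?h = "\<lambda>j. h (t + 2 * pi * real j / real N)"
  have "sqrt (rotation_mean N (\<lambda>t. (h t)\<^sup>2) t) = L2_set ?h {..<N} / sqrt (real N)"
    by (simp add: rotation_mean_def L2_set_def real_sqrt_divide)
  also have "\<dots> \<le> (\<Sum>j<N. ?h j) / sqrt (real N)"
    using assms by (intro divide_right_mono L2_set_le_sum) auto
  also have "\<dots> = sqrt (real N) * rotation_mean N h t"
    using False by (simp add: rotation_mean_def divide_simps)
  finally show ?thesis .
qed

lemma sqrt_rotation_mean_square_add_le:
  fixes A :: "real \<Rightarrow> real" and f :: "real \<Rightarrow> 'a::real_normed_vector"
  shows "sqrt ((rotation_mean N A t)\<^sup>2 + (norm (rotation_mean N f t))\<^sup>2)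
    \<le> rotation_mean N (\<lambda>t. sqrt ((A t)\<^sup>2 + (norm (f t))\<^sup>2)) t"
proof -
  have "norm (rotation_mean N (\<lambda>t. (A t, f t)) t) \<le> rotation_mean N (\<lambda>t. norm (A t, f t)) t"
    by (rule norm_rotation_mean_le)
  moreover have "rotation_mean N (\<lambda>t. (A t, f t)) t = (rotation_mean N A t, rotation_mean N f t)"
    by (simp add: rotation_mean_def sum_prod)
  ultimately show ?thesis
    by (simp add: norm_Pair)
qed

lemma integral_rotation_mean:
  fixes h :: "real \<Rightarrow> 'a::euclidean_space"
  assumes cont: "continuous_on UNIV h" and periodic: "\<And>t. h (t + 2*pi) = h t" and "N > 0"
  shows "integral\<^sup>L torus (rotation_mean N h) = integral\<^sup>L torus h"
proof -
  have "continuous_on UNIV (\<lambda>t. h (t + c))" for c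
    by (intro continuous_on_compose2[OF cont] continuous_intros) auto
  then have "integral\<^sup>L torus (rotation_mean N h)
      = (1 / real N) *\<^sub>R (\<Sum>j<N. \<integral>t. h (t + 2 * pi * real j / real N) \<partial>torus)"
    unfolding rotation_mean_def integral_scaleR_right
    by (subst Bochner_Integration.integral_sum) (auto intro!: integrable_torus_continuous)
  also have "\<dots> = integral\<^sup>L torus h"
    using \<open>N > 0\<close> by (simp add: integral_torus_shift[OF cont periodic] sum_constant_scaleR)
  finally show ?thesis .
qed

lemma rotation_mean_convolution:
  fixes K A :: "real \<Rightarrow> real"
  assumes K: "continuous_on UNIV K" and A: "continuous_on UNIV A"
  shows "rotation_mean N (\<lambda>t. \<integral>s. K (t - s) * A s \<partial>torus) t
    = (\<integral>s. rotation_mean N K (t - s) * A s \<partial>torus)"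
proof -
  have "integrable torus (\<lambda>s. K (c - s) * A s)" for c
    by (intro integrable_torus_continuous continuous_intros A continuous_on_compose2[OF K]) auto
  then have "rotation_mean N (\<lambda>t. \<integral>s. K (t - s) * A s \<partial>torus) t
      = (\<integral>s. (1 / real N) *\<^sub>R (\<Sum>j<N. K (t + 2 * pi * real j / real N - s) * A s) \<partial>torus)"
    unfolding rotation_mean_def integral_scaleR_right
    by (subst Bochner_Integration.integral_sum) auto
  then show ?thesis
    by (simp add: rotation_mean_def sum_distrib_left sum_distrib_right algebra_simps)
qed

lemma cis_of_int_div_eq_1_iff:
  fixes k :: int
  assumes "N > 0"
  shows "cis (2 * pi * of_int k / real N) = 1 \<longleftrightarrow> int N dvd k"
proof -
  have "2 * pi * of_int k / real N = of_int n * (2*pi) \<longleftrightarrow> k = int N * n" for n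
  proof -
    have "2 * pi * of_int k / real N = of_int n * (2*pi) \<longleftrightarrow> real_of_int k = of_int (int N * n)"
      using assms by (simp add: divide_eq_eq) (simp add: mult.commute)
    then show ?thesis by (simp only: of_int_eq_iff)
  qed
  then show ?thesis
    by (simp add: cis_eq_1_iff dvd_def)
qed

lemma rotation_mean_cis:
  fixes k :: int
  assumes "N > 0"
  shows "rotation_mean N (\<lambda>t. cis (of_int k * t)) t = (if int N dvd k then cis (of_int k * t) else 0)"
proof -
  define z where "z = cis (2 * pi * of_int k / real N)"
  have "cis (of_int k * (t + 2 * pi * real j / real N)) = cis (of_int k * t) * z ^ j" for j
    unfolding z_def Complex.DeMoivre cis_mult by (simp add: algebra_simps)
  then have mean: "rotation_mean N (\<lambda>t. cis (of_int k * t)) t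
      = (1 / real N) *\<^sub>R (cis (of_int k * t) * (\<Sum>j<N. z ^ j))"
    by (simp add: rotation_mean_def sum_distrib_left)
  show ?thesis
  proof (cases "int N dvd k")
    case True
    then have "z = 1"
      using assms by (simp add: z_def cis_of_int_div_eq_1_iff)
    then show ?thesis
      using True assms by (simp add: mean scaleR_conv_of_real)
  next
    case False
    have "z ^ N = cis (2 * pi * of_int k)"
      using assms by (simp add: z_def Complex.DeMoivre)
    then have "z ^ N = 1" by simp
    moreover have "z \<noteq> 1"
      using False assms by (simp add: z_def cis_of_int_div_eq_1_iff)
    ultimately show ?thesis
      using False by (simp add: mean geometric_sum)
  qed
qed

section \<open>Dirichlet sums and a reproducing kernel\<close>

definition dirichlet_sum :: "nat \<Rightarrow> real \<Rightarrow> complex" where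
  "dirichlet_sum m t = (\<Sum>j<m. cis (real j * t))"

lemma analytic_trig_poly_dirichlet_sum: "analytic_trig_poly m (dirichlet_sum m)"
proof -
  have "dirichlet_sum m t = (\<Sum>j\<le>m. of_bool (j < m) * cis (real j * t))" for t
    unfolding dirichlet_sum_def by (rule sum.mono_neutral_cong_left) auto
  then show ?thesis
    unfolding analytic_trig_poly_cis by (intro exI[of _ "\<lambda>j. of_bool (j < m)"] ext)
qed

lemma dirichlet_sum_periodic: "dirichlet_sum m (t + 2*pi) = dirichlet_sum m t"
  using analytic_trig_poly_dirichlet_sum by (rule analytic_trig_poly_periodic)

lemma continuous_on_dirichlet_sum [continuous_intros]:
  "continuous_on S f \<Longrightarrow> continuous_on S (\<lambda>x. dirichlet_sum m (f x))"
  unfolding dirichlet_sum_def by (intro continuous_intros)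

lemma integral_norm_dirichlet_sum_square: "(\<integral>t. (cmod (dirichlet_sum m t))\<^sup>2 \<partial>torus) = real m"
  using integral_norm_trig_sum_square[of "{..<m}" "\<lambda>_. 1"] by (simp add: dirichlet_sum_def)

lemma integral_norm_dirichlet_sum_fourth_ge:
  "real m ^ 3 \<le> 3 * (\<integral>t. (cmod (dirichlet_sum m t)) ^ 4 \<partial>torus)"
proof (cases "m = 0")
  case False
  let ?I = "\<integral>t. (cmod (dirichlet_sum m t)) ^ 4 \<partial>torus"
  have "analytic_trig_poly (m + m) (\<lambda>t. dirichlet_sum m t * dirichlet_sum m t)"
    by (intro analytic_trig_poly_mult analytic_trig_poly_dirichlet_sum)
  from norm_analytic_trig_poly_square_le[OF this, of 0]
  have "real m ^ 4 \<le> (2 * real m + 1) * ?I"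
    by (simp add: dirichlet_sum_def norm_mult power4_eq_xxxx power2_eq_square mult.assoc)
  also have "\<dots> \<le> (3 * real m) * ?I"
    using False by (intro mult_right_mono integral_nonneg_AE) auto
  finally have "real m * real m ^ 3 \<le> real m * (3 * ?I)"
    by (simp add: power4_eq_xxxx power3_eq_cube mult_ac)
  with False show ?thesis by simp
qed simp

lemma card_congruent_below:
  fixes i :: nat
  assumes "N > 0"
  shows "card {j. j < m \<and> int N dvd int i - int j} \<le> m div N + 1"
proof -
  let ?S = "{j. j < m \<and> int N dvd int i - int j}"
  have "inj_on (\<lambda>j. j div N) ?S"
  proof (rule inj_onI)
    fix x y assume "x \<in> ?S" "y \<in> ?S" and same_quotient: "x div N = y div N"
    then have "int N dvd (int i - int y) - (int i - int x)"
      by (blast intro: dvd_diff)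
    then have "int x mod int N = int y mod int N"
      by (simp add: mod_eq_dvd_iff)
    then have "x mod N = y mod N"
      by (metis of_nat_eq_iff of_nat_mod)
    with same_quotient show "x = y"
      by (metis div_mult_mod_eq)
  qed
  moreover have "(\<lambda>j. j div N) ` ?S \<subseteq> {..m div N}"
    by (auto intro: div_le_mono)
  ultimately have "card ?S \<le> card {..m div N}"
    by (intro card_inj_on_le) auto
  then show ?thesis by simp
qed

lemma rotation_mean_norm_dirichlet_sum_square_le:
  assumes "N > 0"
  shows "rotation_mean N (\<lambda>t. (cmod (dirichlet_sum m t))\<^sup>2) t \<le> real m * (real m / real N + 1)"
proof -
  let ?e = "\<lambda>i j t. cis (of_int (int i - int j) * t)"
  have norm_square: "complex_of_real ((cmod (dirichlet_sum m t))\<^sup>2) = (\<Sum>i<m. \<Sum>j<m. ?e i j t)" for t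
    unfolding complex_norm_square
    by (simp add: dirichlet_sum_def sum_product cis_cnj cis_mult algebra_simps)
  have "complex_of_real (rotation_mean N (\<lambda>t. (cmod (dirichlet_sum m t))\<^sup>2) t)
      = rotation_mean N (\<lambda>t. \<Sum>i<m. \<Sum>j<m. ?e i j t) t"
    unfolding rotation_mean_def by (simp add: scaleR_conv_of_real norm_square del: of_real_power)
  also have "\<dots> = (\<Sum>i<m. \<Sum>j<m. rotation_mean N (?e i j) t)"
    unfolding rotation_mean_def scaleR_sum_right
    by (subst sum.swap) (rule sum.cong[OF refl], rule sum.swap)
  finally have "norm (complex_of_real (rotation_mean N (\<lambda>t. (cmod (dirichlet_sum m t))\<^sup>2) t))
      \<le> (\<Sum>i<m. \<Sum>j<m. if int N dvd int i - int j then 1 else 0)"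
    by (simp only:) (intro sum_norm_le, simp add: rotation_mean_cis assms del: of_int_diff)
  also have "\<dots> = (\<Sum>i<m. real (card {j. j < m \<and> int N dvd int i - int j}))"
    by (intro sum.cong refl, subst sum.inter_filter[symmetric]) (auto simp: lessThan_def)
  also have "\<dots> \<le> (\<Sum>i<m. real (m div N + 1))"
    by (intro sum_mono) (simp only: of_nat_le_iff card_congruent_below[OF assms])
  also have "\<dots> \<le> (\<Sum>i<m. real m / real N + 1)"
    by (intro sum_mono) (simp add: of_nat_div_le_of_nat)
  finally show ?thesis by (simp add: abs_le_iff)
qed

text \<open>A de la Vallee Poussin type kernel: its Fourier coefficients equal 1 on the frequencies from
  0 to \<open>D\<close>, and as a product of two Dirichlet sums it is dominated by their squares, whose
  rotation means are explicit.\<close>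

definition vp_kernel :: "nat \<Rightarrow> real \<Rightarrow> complex" where
  "vp_kernel D t = cnj (dirichlet_sum (D + 1) t) * dirichlet_sum (2 * D + 1) t / of_nat (D + 1)"

lemma continuous_on_vp_kernel [continuous_intros]:
  "continuous_on S f \<Longrightarrow> continuous_on S (\<lambda>x. vp_kernel D (f x))"
  unfolding vp_kernel_def by (intro continuous_intros) (simp_all only: of_nat_eq_0_iff, simp_all)

lemma vp_kernel_reproduces_cis:
  assumes "l \<le> D"
  shows "(\<integral>s. vp_kernel D (t - s) * cis (real l * s) \<partial>torus) = cis (real l * t)"
proof -
  have shifted: "cnj (dirichlet_sum (D + 1) (t - s)) * cis (real l * s)
      = (\<Sum>j\<in>{l..l + D}. cis (real l * t - real j * t) * cis (real j * s))" for s
    unfolding dirichlet_sum_def cnj_sum sum_distrib_right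
    by (rule sum.reindex_bij_witness[where i = "\<lambda>j. j - l" and j = "\<lambda>j. j + l"])
      (auto simp: cis_cnj cis_mult algebra_simps)
  have conjugated: "dirichlet_sum (2 * D + 1) (t - s)
      = cnj (\<Sum>j<2 * D + 1. cis (- (real j * t)) * cis (real j * s))" for s
    by (simp add: dirichlet_sum_def cis_cnj cis_mult algebra_simps)
  have "(\<integral>s. vp_kernel D (t - s) * cis (real l * s) \<partial>torus)
      = (\<integral>s. (cnj (dirichlet_sum (D + 1) (t - s)) * cis (real l * s))
          * dirichlet_sum (2 * D + 1) (t - s) / of_nat (D + 1) \<partial>torus)"
    by (simp add: vp_kernel_def mult_ac)
  also have "\<dots> = (\<Sum>j\<in>{l..l + D} \<inter> {..<2 * D + 1}.
      cis (real l * t - real j * t) * cnj (cis (- (real j * t)))) / of_nat (D + 1)"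
    unfolding shifted conjugated integral_divide_zero
    by (subst integral_trig_sum_mult_cnj) simp_all
  also have "{l..l + D} \<inter> {..<2 * D + 1} = {l..l + D}"
    using assms by auto
  also have "(\<Sum>j\<in>{l..l + D}. cis (real l * t - real j * t) * cnj (cis (- (real j * t)))) / of_nat (D + 1)
      = cis (real l * t)"
    by (simp add: cis_cnj cis_mult del: of_nat_Suc of_nat_add)
  finally show ?thesis .
qed

lemma vp_kernel_reproduces:
  assumes "analytic_trig_poly d f" and "d \<le> D"
  shows "(\<integral>s. vp_kernel D (t - s) * f s \<partial>torus) = f t"
proof -
  obtain a where f: "f = (\<lambda>t. \<Sum>j\<le>d. a j * cis (real j * t))"
    using assms by (auto simp: analytic_trig_poly_cis)
  have "(\<integral>s. vp_kernel D (t - s) * f s \<partial>torus)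
      = (\<integral>s. (\<Sum>j\<le>d. a j * (vp_kernel D (t - s) * cis (real j * s))) \<partial>torus)"
    by (simp add: f sum_distrib_left mult_ac)
  also have "\<dots> = (\<Sum>j\<le>d. \<integral>s. a j * (vp_kernel D (t - s) * cis (real j * s)) \<partial>torus)"
    by (intro Bochner_Integration.integral_sum integrable_torus_continuous continuous_intros)
  also have "\<dots> = f t"
    using \<open>d \<le> D\<close> by (simp add: f vp_kernel_reproduces_cis)
  finally show ?thesis .
qed

lemma rotation_mean_norm_vp_kernel_le:
  assumes "N > 0"
  shows "rotation_mean N (\<lambda>t. cmod (vp_kernel D t)) t \<le> 5 * (real D + 1) / real N + 3"
proof -
  let ?m = "real D + 1"
  let ?u = "\<lambda>t. (cmod (dirichlet_sum (D + 1) t))\<^sup>2"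
  let ?v = "\<lambda>t. (cmod (dirichlet_sum (2 * D + 1) t))\<^sup>2"
  have "cmod (vp_kernel D t) \<le> (?u t + ?v t) / ?m" for t
  proof -
    have "x * y \<le> x\<^sup>2 + y\<^sup>2" if "x \<ge> 0" "y \<ge> 0" for x y :: real
      using sum_squares_bound[of x y] mult_nonneg_nonneg[OF that] by linarith
    then have "cmod (dirichlet_sum (D + 1) t) * cmod (dirichlet_sum (2 * D + 1) t) \<le> ?u t + ?v t"
      by simp
    moreover have "cmod (of_nat (D + 1)) = ?m"
      unfolding norm_of_nat by simp
    ultimately show ?thesis
      by (simp add: vp_kernel_def norm_divide norm_mult divide_right_mono)
  qed
  then have "rotation_mean N (\<lambda>t. cmod (vp_kernel D t)) t \<le> rotation_mean N (\<lambda>t. (?u t + ?v t) / ?m) t"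
    by (rule rotation_mean_mono)
  also have "\<dots> = (rotation_mean N ?u t + rotation_mean N ?v t) / ?m"
    by (simp add: rotation_mean_def sum.distrib add_divide_distrib sum_divide_distrib mult.commute)
  also have "\<dots> \<le> (?m * (?m / real N + 1) + 2 * ?m * (2 * ?m / real N + 1)) / ?m"
  proof (intro divide_right_mono add_mono)
    show "rotation_mean N ?u t \<le> ?m * (?m / real N + 1)"
      using rotation_mean_norm_dirichlet_sum_square_le[OF assms, of "D + 1" t]
      by (simp add: add.commute)
    have "rotation_mean N ?v t \<le> real (2 * D + 1) * (real (2 * D + 1) / real N + 1)"
      by (rule rotation_mean_norm_dirichlet_sum_square_le[OF assms])
    also have "\<dots> \<le> 2 * ?m * (2 * ?m / real N + 1)"
      by (intro mult_mono add_right_mono divide_right_mono) auto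
    finally show "rotation_mean N ?v t \<le> 2 * ?m * (2 * ?m / real N + 1)" .
  qed simp
  also have "\<dots> = 5 * ?m / real N + 3"
  proof -
    have "(x * (x / y + 1) + 2 * x * (2 * x / y + 1)) / x = 5 * x / y + 3"
      if "x > 0" "y > 0" for x y :: real
      using that by (simp add: field_simps)
    from this[of ?m "real N"] assms show ?thesis by simp
  qed
  finally show ?thesis .
qed

section \<open>Square functions\<close>

lemma integrable_L2_set:
  fixes h :: "'i \<Rightarrow> 'a \<Rightarrow> real"
  assumes "\<And>k. k \<in> S \<Longrightarrow> integrable M (h k)"
  shows "integrable M (\<lambda>x. L2_set (\<lambda>k. h k x) S)"
proof (rule Bochner_Integration.integrable_bound)
  show "integrable M (\<lambda>x. \<Sum>k\<in>S. \<bar>h k x\<bar>)"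
    using assms by (intro Bochner_Integration.integrable_sum integrable_abs)
  have [measurable]: "h k \<in> borel_measurable M" if "k \<in> S" for k
    using assms[OF that] by (rule borel_measurable_integrable)
  show "(\<lambda>x. L2_set (\<lambda>k. h k x) S) \<in> borel_measurable M"
    unfolding L2_set_def by measurable
qed (simp add: L2_set_le_sum_abs sum_nonneg)

lemma L2_set_norm_integral_le:
  fixes g :: "'i \<Rightarrow> 'a \<Rightarrow> 'b::{banach, second_countable_topology}"
  assumes "\<And>k. k \<in> S \<Longrightarrow> integrable M (g k)"
  shows "L2_set (\<lambda>k. norm (\<integral>x. g k x \<partial>M)) S \<le> (\<integral>x. L2_set (\<lambda>k. norm (g k x)) S \<partial>M)"
proof -
  let ?u = "\<lambda>k. \<integral>x. norm (g k x) \<partial>M" and ?G = "\<lambda>x. L2_set (\<lambda>k. norm (g k x)) S"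
  have "(L2_set ?u S)\<^sup>2 = (\<Sum>k\<in>S. ?u k * ?u k)"
    by (simp add: L2_set_def sum_nonneg power2_eq_square)
  also have "\<dots> = (\<integral>x. (\<Sum>k\<in>S. ?u k * norm (g k x)) \<partial>M)"
    using assms by (simp add: Bochner_Integration.integral_sum)
  also have "\<dots> \<le> (\<integral>x. L2_set ?u S * ?G x \<partial>M)"
  proof (rule integral_mono)
    fix x
    show "(\<Sum>k\<in>S. ?u k * norm (g k x)) \<le> L2_set ?u S * ?G x"
      using L2_set_mult_ineq[of ?u "\<lambda>k. norm (g k x)" S] by simp
  qed (use assms in \<open>auto intro!: integrable_L2_set\<close>)
  finally have "L2_set ?u S * L2_set ?u S \<le> L2_set ?u S * (\<integral>x. ?G x \<partial>M)"
    by (simp add: power2_eq_square)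
  then have "L2_set ?u S \<le> (\<integral>x. ?G x \<partial>M)"
    using L2_set_nonneg[of ?u S] by (cases "L2_set ?u S = 0") (auto simp: mult_le_cancel_left)
  moreover have "L2_set (\<lambda>k. norm (\<integral>x. g k x \<partial>M)) S \<le> L2_set ?u S"
    by (intro L2_set_mono integral_norm_bound) simp
  ultimately show ?thesis by (rule order_trans[rotated])
qed

lemma L2_set_mono_neutral:
  assumes "finite T" and "S \<subseteq> T" and "\<And>k. k \<in> T - S \<Longrightarrow> x k = 0"
  shows "L2_set x T = L2_set x S"
  unfolding L2_set_def using assms by (intro arg_cong[where f = sqrt] sum.mono_neutral_right) auto

lemma L2_set_le_sum_fibers:
  assumes "finite S" and "finite T" and "\<phi> ` S \<subseteq> T"
  shows "L2_set x S \<le> (\<Sum>r\<in>T. L2_set x {k \<in> S. \<phi> k = r})"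
proof -
  have "(\<Sum>k\<in>S. (x k)\<^sup>2) = (\<Sum>r\<in>T. \<Sum>k\<in>{k \<in> S. \<phi> k = r}. (x k)\<^sup>2)"
    using assms by (intro sum.group[symmetric])
  then have "L2_set x S = L2_set (\<lambda>r. L2_set x {k \<in> S. \<phi> k = r}) T"
    by (simp add: L2_set_def sum_nonneg)
  also have "\<dots> \<le> (\<Sum>r\<in>T. L2_set x {k \<in> S. \<phi> k = r})"
    by (rule L2_set_le_sum) simp
  finally show ?thesis .
qed

definition square_function :: "'i set \<Rightarrow> ('i \<Rightarrow> 'a \<Rightarrow> 'b::real_normed_vector) \<Rightarrow> 'a \<Rightarrow> real" where
  "square_function S g x = L2_set (\<lambda>k. norm (g k x)) S"

lemma square_function_nonneg: "square_function S g x \<ge> 0"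
  by (simp add: square_function_def)

lemma square_function_mono:
  assumes "finite T" and "S \<subseteq> T"
  shows "square_function S g x \<le> square_function T g x"
  unfolding square_function_def L2_set_def using assms by (intro real_sqrt_le_mono sum_mono2) auto

lemma square_function_insert:
  assumes "finite S" and "k \<notin> S"
  shows "square_function (insert k S) g x = sqrt ((square_function S g x)\<^sup>2 + (norm (g k x))\<^sup>2)"
  using assms by (simp add: square_function_def add.commute)

lemma integrable_square_function:
  fixes g :: "'i \<Rightarrow> 'a \<Rightarrow> 'b::{banach, second_countable_topology}"
  assumes "\<And>k. k \<in> S \<Longrightarrow> integrable M (g k)"
  shows "integrable M (square_function S g)"
  unfolding square_function_def using assms by (intro integrable_L2_set integrable_norm)

lemma integral_square_function_le_sum_fibers:
  fixes g :: "'i \<Rightarrow> 'a \<Rightarrow> 'b::{banach, second_countable_topology}"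
  assumes integrable: "\<And>k. k \<in> S \<Longrightarrow> integrable M (g k)"
    and "finite S" and "finite T" and "\<phi> ` S \<subseteq> T"
  shows "integral\<^sup>L M (square_function S g)
    \<le> (\<Sum>r\<in>T. integral\<^sup>L M (square_function {k \<in> S. \<phi> k = r} g))"
proof -
  have "integral\<^sup>L M (square_function S g) \<le> (\<integral>x. (\<Sum>r\<in>T. square_function {k \<in> S. \<phi> k = r} g x) \<partial>M)"
  proof (intro integral_mono Bochner_Integration.integrable_sum integrable_square_function integrable)
    show "square_function S g x \<le> (\<Sum>r\<in>T. square_function {k \<in> S. \<phi> k = r} g x)" for x
      unfolding square_function_def using assms by (intro L2_set_le_sum_fibers)
  qed auto
  also have "\<dots> = (\<Sum>r\<in>T. integral\<^sup>L M (square_function {k \<in> S. \<phi> k = r} g))"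
    by (intro Bochner_Integration.integral_sum integrable_square_function integrable) auto
  finally show ?thesis .
qed

lemma continuous_on_square_function_analytic:
  assumes "\<And>k. k \<in> S \<Longrightarrow> analytic_trig_poly (d k) (f k)"
  shows "continuous_on UNIV (square_function S f)"
  unfolding square_function_def L2_set_def
  by (intro continuous_intros) (use assms analytic_trig_poly_continuous in blast)

section \<open>Couplings of uniform variables\<close>

locale torus_coupling = prob_space W for W :: "'w measure" +
  fixes I :: "'i set" and X :: "'i \<Rightarrow> 'w \<Rightarrow> real"
  assumes measurable_X: "k \<in> I \<Longrightarrow> X k \<in> measurable W torus"
    and distr_X: "k \<in> I \<Longrightarrow> distr W torus (X k) = torus"
begin

lemma integrable_coupling:
  fixes \<phi> :: "real \<Rightarrow> 'a::{banach, second_countable_topology}"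
  assumes "k \<in> I" and "continuous_on UNIV \<phi>"
  shows "integrable W (\<lambda>w. \<phi> (X k w))"
proof -
  have "integrable (distr W torus (X k)) \<phi>"
    using integrable_torus_continuous[OF assms(2)] distr_X[OF assms(1)] by simp
  then show ?thesis
    by (rule integrable_distr[OF measurable_X[OF assms(1)]])
qed

lemma integral_coupling:
  fixes \<phi> :: "real \<Rightarrow> 'a::{banach, second_countable_topology}"
  assumes "k \<in> I" and "continuous_on UNIV \<phi>"
  shows "(\<integral>w. \<phi> (X k w) \<partial>W) = integral\<^sup>L torus \<phi>"
  using integral_distr[OF measurable_X[OF assms(1)] borel_measurable_torus_continuous[OF assms(2)]]
  by (simp add: distr_X[OF assms(1)])

lemma integral_mult_coupling_le:
  fixes \<phi> \<psi> :: "real \<Rightarrow> real"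
  assumes "k \<in> I" and "continuous_on UNIV \<phi>" and "\<And>t. \<phi> t \<ge> 0" and "\<And>t. \<psi> t \<le> b" and "b \<ge> 0"
  shows "(\<integral>w. \<phi> (X k w) * \<psi> (X l w) \<partial>W) \<le> b * integral\<^sup>L torus \<phi>"
proof -
  have "(\<integral>w. \<phi> (X k w) * \<psi> (X l w) \<partial>W) \<le> (\<integral>w. b * \<phi> (X k w) \<partial>W)"
    using assms integrable_coupling[OF assms(1,2)]
    by (intro integral_mono') (auto simp: mult.commute[of b] intro!: mult_left_mono)
  then show ?thesis
    by (simp add: integral_coupling[OF assms(1,2)])
qed

end

lemma torus_coupling_identity: "torus_coupling torus I (\<lambda>k t. t)"
proof -
  interpret prob_space torus by (rule prob_space_torus)
  show ?thesis
    by standard (use distr_id[of torus] in \<open>simp_all add: id_def\<close>)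
qed

lemma torus_coupling_product: "torus_coupling (PiM I (\<lambda>_. torus)) I (\<lambda>k x. x k)"
proof -
  interpret prob_space "PiM I (\<lambda>_. torus)"
    by (intro prob_space_PiM prob_space_torus)
  show ?thesis
    by standard (simp_all add: measurable_component_singleton
        distr_PiM_component[of I "\<lambda>_. torus", OF prob_space_torus])
qed

lemma torus_coupling_reindex:
  assumes "torus_coupling W I X" and "\<sigma> ` J \<subseteq> I"
  shows "torus_coupling W J (\<lambda>j. X (\<sigma> j))"
proof -
  interpret torus_coupling W I X by fact
  show ?thesis
    by standard (use assms(2) measurable_X distr_X in auto)
qed

section \<open>The upper bound\<close>

lemma square_function_le_vp_kernel:
  assumes f: "\<And>k. k \<in> S \<Longrightarrow> analytic_trig_poly (d k) (f k)" and d: "\<And>k. k \<in> S \<Longrightarrow> d k \<le> D"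
  shows "square_function S f t \<le> (\<integral>s. cmod (vp_kernel D (t - s)) * square_function S f s \<partial>torus)"
proof -
  have "square_function S f t = L2_set (\<lambda>k. cmod (\<integral>s. vp_kernel D (t - s) * f k s \<partial>torus)) S"
    unfolding square_function_def
    by (intro L2_set_cong refl) (simp add: vp_kernel_reproduces[OF f d])
  also have "\<dots> \<le> (\<integral>s. L2_set (\<lambda>k. cmod (vp_kernel D (t - s) * f k s)) S \<partial>torus)"
    by (intro L2_set_norm_integral_le integrable_torus_continuous continuous_intros
        analytic_trig_poly_continuous[OF f])
  also have "\<dots> = (\<integral>s. cmod (vp_kernel D (t - s)) * square_function S f s \<partial>torus)"
    by (simp add: square_function_def norm_mult L2_set_right_distrib)
  finally show ?thesis .
qed

lemma rotation_mean_square_function_le: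
  assumes f: "\<And>k. k \<in> S \<Longrightarrow> analytic_trig_poly (d k) (f k)"
    and d: "\<And>k. k \<in> S \<Longrightarrow> real (d k) \<le> C * real N" and "C \<ge> 0" and "N > 0"
  shows "rotation_mean N (square_function S f) t \<le> (5 * C + 8) * integral\<^sup>L torus (square_function S f)"
proof -
  define D where "D = nat \<lfloor>C * real N\<rfloor>"
  have d_le: "d k \<le> D" if "k \<in> S" for k
    using d[OF that] unfolding D_def by (simp add: le_nat_floor)
  have "real D \<le> C * real N"
    unfolding D_def using \<open>C \<ge> 0\<close> by (simp add: of_nat_floor)
  then have "5 * (real D + 1) \<le> (5 + 5 * C) * real N"
    using \<open>N > 0\<close> by (simp add: algebra_simps)
  then have "5 * (real D + 1) / real N \<le> 5 + 5 * C"
    using \<open>N > 0\<close> by (simp add: divide_le_eq)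
  then have kernel_le: "rotation_mean N (\<lambda>x. cmod (vp_kernel D x)) s \<le> 5 * C + 8" for s
    using rotation_mean_norm_vp_kernel_le[OF \<open>N > 0\<close>, of D s] by linarith
  note cont_A = continuous_on_square_function_analytic[where S = S and d = d, OF f]
  have "rotation_mean N (square_function S f) t
      \<le> rotation_mean N (\<lambda>t. \<integral>s. cmod (vp_kernel D (t - s)) * square_function S f s \<partial>torus) t"
    using f d_le by (intro rotation_mean_mono square_function_le_vp_kernel)
  also have "\<dots> = (\<integral>s. rotation_mean N (\<lambda>x. cmod (vp_kernel D x)) (t - s) * square_function S f s \<partial>torus)"
    by (intro rotation_mean_convolution cont_A continuous_intros)
  also have "\<dots> \<le> (\<integral>s. (5 * C + 8) * square_function S f s \<partial>torus)"
    by (intro integral_mono integrable_torus_continuous continuous_intros cont_A mult_right_mono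
        kernel_le square_function_nonneg continuous_on_compose2[OF continuous_on_rotation_mean]) auto
  finally show ?thesis by simp
qed

definition sqrt_increment :: "real \<Rightarrow> real \<Rightarrow> real" where
  "sqrt_increment r x = sqrt (r\<^sup>2 + x\<^sup>2) - r"

lemma continuous_on_sqrt_increment [continuous_intros]:
  "continuous_on S r \<Longrightarrow> continuous_on S g \<Longrightarrow> continuous_on S (\<lambda>t. sqrt_increment (r t) (g t))"
  unfolding sqrt_increment_def by (intro continuous_intros)

lemma sqrt_increment_antimono:
  assumes "s \<le> r"
  shows "sqrt_increment r x \<le> sqrt_increment s x"
  using real_sqrt_sum_squares_triangle_ineq[of s "r - s" x 0] assms by (simp add: sqrt_increment_def)

lemma L2_set_le_sum_sqrt_increment:
  assumes "finite S" and "R \<ge> 0"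
  shows "L2_set x S \<le> R + (\<Sum>k\<in>S. sqrt_increment R (x k))"
proof -
  have "sqrt (R\<^sup>2 + (\<Sum>k\<in>S. (x k)\<^sup>2)) \<le> R + (\<Sum>k\<in>S. sqrt_increment R (x k))"
    using \<open>finite S\<close>
  proof induction
    case empty
    then show ?case using \<open>R \<ge> 0\<close> by simp
  next
    case (insert k S)
    let ?s = "sqrt (R\<^sup>2 + (\<Sum>k\<in>S. (x k)\<^sup>2))"
    have "R \<le> ?s"
      by (intro real_le_rsqrt) (simp add: sum_nonneg)
    then have "sqrt_increment ?s (x k) \<le> sqrt_increment R (x k)"
      by (rule sqrt_increment_antimono)
    moreover have "?s\<^sup>2 + (x k)\<^sup>2 = R\<^sup>2 + (\<Sum>k\<in>insert k S. (x k)\<^sup>2)"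
      using insert by (simp add: sum_nonneg)
    ultimately show ?case
      using insert by (simp add: sqrt_increment_def)
  qed
  moreover have "L2_set x S \<le> sqrt (R\<^sup>2 + (\<Sum>k\<in>S. (x k)\<^sup>2))"
    unfolding L2_set_def by (intro real_sqrt_le_mono) simp
  ultimately show ?thesis by (rule order_trans[rotated])
qed

lemma integral_sqrt_increment_le:
  fixes A :: "real \<Rightarrow> real" and f :: "real \<Rightarrow> 'a::real_normed_vector"
  assumes cont [continuous_intros]: "continuous_on UNIV A" "continuous_on UNIV f"
    and periodic: "\<And>t. A (t + 2*pi) = A t" "\<And>t. f (t + 2*pi) = f t"
    and "N > 0" and mean_le: "\<And>t. rotation_mean N A t \<le> R"
  shows "(\<integral>t. sqrt_increment R (norm (rotation_mean N f t)) \<partial>torus)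
    \<le> (\<integral>t. sqrt ((A t)\<^sup>2 + (norm (f t))\<^sup>2) \<partial>torus) - integral\<^sup>L torus A"
proof -
  let ?H = "\<lambda>t. sqrt ((A t)\<^sup>2 + (norm (f t))\<^sup>2)"
  have cont_H: "continuous_on UNIV ?H"
    by (intro continuous_intros)
  note cont_means = continuous_on_rotation_mean[OF cont(1)] continuous_on_rotation_mean[OF cont(2)]
    continuous_on_rotation_mean[OF cont_H]
  have "sqrt_increment R (norm (rotation_mean N f t)) \<le> rotation_mean N ?H t - rotation_mean N A t" for t
    using sqrt_increment_antimono[OF mean_le, of "norm (rotation_mean N f t)" t]
      sqrt_rotation_mean_square_add_le[of N A t f]
    by (simp add: sqrt_increment_def)
  then have "(\<integral>t. sqrt_increment R (norm (rotation_mean N f t)) \<partial>torus)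
      \<le> (\<integral>t. rotation_mean N ?H t - rotation_mean N A t \<partial>torus)"
    by (intro integral_mono integrable_torus_continuous continuous_intros cont_means)
  also have "\<dots> = integral\<^sup>L torus (rotation_mean N ?H) - integral\<^sup>L torus (rotation_mean N A)"
    by (intro Bochner_Integration.integral_diff integrable_torus_continuous cont_means)
  also have "\<dots> = integral\<^sup>L torus ?H - integral\<^sup>L torus A"
    using \<open>N > 0\<close> by (simp add: integral_rotation_mean cont cont_H periodic)
  finally show ?thesis .
qed

lemma sum_integral_sqrt_increment_le:
  fixes d N :: "'i::linorder \<Rightarrow> nat"
  assumes "finite S" and "\<And>k. k \<in> S \<Longrightarrow> analytic_trig_poly (d k) (f k)"
    and "\<And>k. k \<in> S \<Longrightarrow> N k > 0" and "C \<ge> 0"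
    and "\<And>k l. k \<in> S \<Longrightarrow> l \<in> S \<Longrightarrow> k < l \<Longrightarrow> real (d k) \<le> C * real (N l)"
    and "(5 * C + 8) * integral\<^sup>L torus (square_function S f) \<le> R"
  shows "(\<Sum>k\<in>S. \<integral>t. sqrt_increment R (cmod (rotation_mean (N k) (f k) t)) \<partial>torus)
    \<le> integral\<^sup>L torus (square_function S f)"
  using assms
proof (induction S rule: finite_linorder_max_induct)
  case empty
  then show ?case by (auto intro!: integral_nonneg_AE simp: square_function_nonneg)
next
  case (insert b S)
  let ?A = "square_function S f" and ?A' = "square_function (insert b S) f"
  have "b \<notin> S" using insert.hyps by auto
  then have A'_eq: "?A' = (\<lambda>t. sqrt ((?A t)\<^sup>2 + (cmod (f b t))\<^sup>2))"
    using insert.hyps by (auto simp: square_function_insert)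
  have f: "analytic_trig_poly (d k) (f k)" if "k \<in> insert b S" for k
    using insert.prems that by blast
  have cont: "continuous_on UNIV ?A" "continuous_on UNIV ?A'"
    using f by (auto intro!: continuous_on_square_function_analytic)
  have "integral\<^sup>L torus ?A \<le> integral\<^sup>L torus ?A'"
    using insert.hyps by (intro integral_mono integrable_torus_continuous cont square_function_mono) auto
  then have R: "(5 * C + 8) * integral\<^sup>L torus ?A \<le> R"
    using insert.prems(5) \<open>C \<ge> 0\<close> by (auto intro: order_trans[OF mult_left_mono])
  have mean_le: "rotation_mean (N b) ?A t \<le> R" for t
    by (rule order_trans[OF rotation_mean_square_function_le[where d = d and C = C] R])
      (use insert.prems insert.hyps in auto)
  have "?A (t + 2*pi) = ?A t" for t
    unfolding square_function_def using analytic_trig_poly_periodic[OF f] by (intro L2_set_cong) auto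
  then have "(\<integral>t. sqrt_increment R (cmod (rotation_mean (N b) (f b) t)) \<partial>torus)
      \<le> integral\<^sup>L torus ?A' - integral\<^sup>L torus ?A"
    unfolding A'_eq using insert.prems(2) f[of b] mean_le
    by (intro integral_sqrt_increment_le cont)
      (auto intro: analytic_trig_poly_continuous analytic_trig_poly_periodic)
  moreover have "(\<Sum>k\<in>S. \<integral>t. sqrt_increment R (cmod (rotation_mean (N k) (f k) t)) \<partial>torus)
      \<le> integral\<^sup>L torus ?A"
    using insert.prems R by (intro insert.IH) auto
  ultimately show ?case
    using insert.hyps \<open>b \<notin> S\<close> by simp
qed

lemma integral_square_function_rotation_mean_le:
  fixes d N :: "'i::linorder \<Rightarrow> nat"
  assumes "torus_coupling W I X"
    and S: "finite S" "S \<subseteq> I" and f: "\<And>k. k \<in> S \<Longrightarrow> analytic_trig_poly (d k) (f k)"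
    and N: "\<And>k. k \<in> S \<Longrightarrow> N k > 0" and "C \<ge> 0"
    and d: "\<And>k l. k \<in> S \<Longrightarrow> l \<in> S \<Longrightarrow> k < l \<Longrightarrow> real (d k) \<le> C * real (N l)"
  shows "integral\<^sup>L W (square_function S (\<lambda>k w. rotation_mean (N k) (f k) (X k w)))
    \<le> (5 * C + 9) * integral\<^sup>L torus (square_function S f)"
proof -
  interpret torus_coupling W I X by fact
  define R where "R = (5 * C + 8) * integral\<^sup>L torus (square_function S f)"
  let ?h = "\<lambda>k t. sqrt_increment R (cmod (rotation_mean (N k) (f k) t))"
  have "R \<ge> 0"
    using \<open>C \<ge> 0\<close>
    by (auto simp: R_def square_function_nonneg intro!: mult_nonneg_nonneg integral_nonneg_AE)
  have cont_mean: "continuous_on UNIV (rotation_mean (N k) (f k))" if "k \<in> S" for k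
    using f[OF that] by (intro continuous_on_rotation_mean analytic_trig_poly_continuous)
  then have cont: "continuous_on UNIV (?h k)" if "k \<in> S" for k
    using that by (intro continuous_intros)
  have integrable: "integrable W (\<lambda>w. ?h k (X k w))" if "k \<in> S" for k
    using that S by (intro integrable_coupling[where \<phi> = "?h k"] cont) auto
  have "integral\<^sup>L W (square_function S (\<lambda>k w. rotation_mean (N k) (f k) (X k w)))
      \<le> (\<integral>w. R + (\<Sum>k\<in>S. ?h k (X k w)) \<partial>W)"
  proof (rule integral_mono)
    show "integrable W (square_function S (\<lambda>k w. rotation_mean (N k) (f k) (X k w)))"
      using S(2) cont_mean by (intro integrable_square_function integrable_coupling) auto
    show "integrable W (\<lambda>w. R + (\<Sum>k\<in>S. ?h k (X k w)))"
      using integrable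
      by (intro Bochner_Integration.integrable_add Bochner_Integration.integrable_sum) auto
    show "square_function S (\<lambda>k w. rotation_mean (N k) (f k) (X k w)) w
        \<le> R + (\<Sum>k\<in>S. ?h k (X k w))" for w
      unfolding square_function_def using S(1) \<open>R \<ge> 0\<close> by (rule L2_set_le_sum_sqrt_increment)
  qed
  also have "\<dots> = R + (\<Sum>k\<in>S. \<integral>w. ?h k (X k w) \<partial>W)"
    using integrable by (simp add: prob_space)
  also have "(\<Sum>k\<in>S. \<integral>w. ?h k (X k w) \<partial>W) = (\<Sum>k\<in>S. integral\<^sup>L torus (?h k))"
    using S cont by (intro sum.cong refl integral_coupling[where \<phi> = "?h _"]) auto
  also have "\<dots> \<le> integral\<^sup>L torus (square_function S f)"
    using S(1) f N \<open>C \<ge> 0\<close> d by (rule sum_integral_sqrt_increment_le) (simp_all add: R_def)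
  finally show ?thesis
    by (simp add: R_def algebra_simps)
qed

lemma integral_square_function_rotation_mean_le_separated:
  fixes d N :: "nat \<Rightarrow> nat"
  assumes coupling: "torus_coupling W I X"
    and S: "finite S" "S \<subseteq> I" and f: "\<And>k. k \<in> S \<Longrightarrow> analytic_trig_poly (d k) (f k)"
    and N: "\<And>k. k \<in> S \<Longrightarrow> N k > 0" and "C \<ge> 0" and "a > 0"
    and d: "\<And>k l. k \<in> S \<Longrightarrow> l \<in> S \<Longrightarrow> k + a \<le> l \<Longrightarrow> real (d k) \<le> C * real (N l)"
  shows "integral\<^sup>L W (square_function S (\<lambda>k w. rotation_mean (N k) (f k) (X k w)))
    \<le> real a * (5 * C + 9) * integral\<^sup>L torus (square_function S f)"
proof -
  interpret torus_coupling W I X by fact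
  let ?g = "\<lambda>k w. rotation_mean (N k) (f k) (X k w)"
  define P where "P r = {k \<in> S. k mod a = r}" for r
  have P: "P r \<subseteq> S" "finite (P r)" for r
    using S by (auto simp: P_def)
  then have f_P: "analytic_trig_poly (d k) (f k)" if "k \<in> P r" for k r
    using that f by blast
  have gap: "k + a \<le> l" if "k \<in> P r" "l \<in> P r" "k < l" for k l r
    using that mod_eq_dvd_iff_nat[of k l a] dvd_imp_le[of a "l - k"] by (simp add: P_def)
  have "integral\<^sup>L W (square_function (P r) ?g)
      \<le> (5 * C + 9) * integral\<^sup>L torus (square_function S f)" for r
  proof -
    have "integral\<^sup>L W (square_function (P r) ?g)
        \<le> (5 * C + 9) * integral\<^sup>L torus (square_function (P r) f)"
    proof (rule integral_square_function_rotation_mean_le[OF coupling])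
      show "analytic_trig_poly (d k) (f k)" "N k > 0" if "k \<in> P r" for k
        using that f_P P N by blast+
      show "real (d k) \<le> C * real (N l)" if "k \<in> P r" "l \<in> P r" "k < l" for k l
        using that P gap d by blast
    qed (use P S \<open>C \<ge> 0\<close> in auto)
    also have "\<dots> \<le> (5 * C + 9) * integral\<^sup>L torus (square_function S f)"
      using P S \<open>C \<ge> 0\<close>
      by (intro mult_left_mono integral_mono integrable_torus_continuous square_function_mono
          continuous_on_square_function_analytic[OF f] continuous_on_square_function_analytic[OF f_P]) auto
    finally show ?thesis .
  qed
  then have "(\<Sum>r<a. integral\<^sup>L W (square_function (P r) ?g))
      \<le> (\<Sum>r<a. (5 * C + 9) * integral\<^sup>L torus (square_function S f))"
    by (rule sum_mono)
  moreover have "integral\<^sup>L W (square_function S ?g) \<le> (\<Sum>r<a. integral\<^sup>L W (square_function (P r) ?g))"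
    unfolding P_def using S f \<open>a > 0\<close>
    by (intro integral_square_function_le_sum_fibers integrable_coupling continuous_on_rotation_mean
        analytic_trig_poly_continuous[OF f]) auto
  ultimately show ?thesis by (simp add: mult.assoc)
qed

section \<open>Almost disjoint functions\<close>

lemma sum_le_L2_set_plus_sqrt_products:
  fixes x :: "nat \<Rightarrow> real"
  assumes "\<And>i. x i \<ge> 0"
  shows "(\<Sum>i<b. x i) \<le> L2_set x {..<b} + (\<Sum>j<b. \<Sum>i<j. sqrt (x i) * sqrt (x j))"
proof (induction b)
  case 0
  then show ?case by simp
next
  case (Suc b)
  let ?A = "L2_set x {..<b}" and ?P = "\<Sum>i<b. sqrt (x i) * sqrt (x b)"
  have L2_Suc: "L2_set x {..<Suc b} = sqrt ((x b)\<^sup>2 + ?A\<^sup>2)"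
    by (simp add: lessThan_Suc)
  have "min ?A (x b) \<le> ?P"
  proof (cases "\<exists>i<b. x b \<le> x i")
    case True
    then obtain i where i: "i < b" "x b \<le> x i" by blast
    have "x b = sqrt (x b) * sqrt (x b)" using assms by simp
    also have "\<dots> \<le> sqrt (x i) * sqrt (x b)"
      using i assms by (intro mult_right_mono) auto
    also have "\<dots> \<le> ?P"
      by (rule member_le_sum) (use i assms in auto)
    finally show ?thesis by simp
  next
    case False
    have "?A \<le> (\<Sum>i<b. x i)"
      using assms by (intro L2_set_le_sum) auto
    also have "\<dots> = (\<Sum>i<b. sqrt (x i) * sqrt (x i))"
      using assms by simp
    also have "\<dots> \<le> ?P"
      using False assms by (intro sum_mono mult_left_mono) auto
    finally show ?thesis by simp
  qed
  moreover have "x b \<le> L2_set x {..<Suc b}" "?A \<le> L2_set x {..<Suc b}"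
    unfolding L2_Suc by (auto intro: real_le_rsqrt)
  ultimately have "?A + x b \<le> L2_set x {..<Suc b} + ?P"
    by (simp add: min_def split: if_splits)
  then show ?case
    using Suc by simp
qed

lemma integrable_sqrt_mult_sqrt:
  fixes g h :: "'a \<Rightarrow> real"
  assumes "integrable M g" and "integrable M h" and "\<And>x. g x \<ge> 0" and "\<And>x. h x \<ge> 0"
  shows "integrable M (\<lambda>x. sqrt (g x) * sqrt (h x))"
proof (rule Bochner_Integration.integrable_bound)
  show "integrable M (\<lambda>x. g x + h x)"
    using assms by simp
  have [measurable]: "g \<in> borel_measurable M" "h \<in> borel_measurable M"
    using assms by auto
  show "(\<lambda>x. sqrt (g x) * sqrt (h x)) \<in> borel_measurable M"
    by measurable
  have "sqrt (g x) * sqrt (h x) \<le> g x + h x" for x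
    using sum_squares_bound[of "sqrt (g x)" "sqrt (h x)"] assms(3,4)[of x] by simp
  then show "AE x in M. norm (sqrt (g x) * sqrt (h x)) \<le> norm (g x + h x)"
    using assms(3,4) by (simp add: abs_mult)
qed

lemma sum_integral_le_integral_L2_set:
  fixes G :: "nat \<Rightarrow> 'a \<Rightarrow> real"
  assumes integrable: "\<And>i. i < b \<Longrightarrow> integrable M (G i)" and nonneg: "\<And>i x. G i x \<ge> 0"
  shows "(\<Sum>i<b. integral\<^sup>L M (G i)) \<le> (\<integral>x. L2_set (\<lambda>i. G i x) {..<b} \<partial>M)
    + (\<Sum>j<b. \<Sum>i<j. \<integral>x. sqrt (G i x) * sqrt (G j x) \<partial>M)"
proof -
  have integrable_pair: "integrable M (\<lambda>x. sqrt (G i x) * sqrt (G j x))" if "i < j" "j < b" for i j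
    using that by (intro integrable_sqrt_mult_sqrt integrable nonneg) auto
  then have integrable_row: "integrable M (\<lambda>x. \<Sum>i<j. sqrt (G i x) * sqrt (G j x))" if "j < b" for j
    using that by (intro Bochner_Integration.integrable_sum) auto
  have integrable_L2: "integrable M (\<lambda>x. L2_set (\<lambda>i. G i x) {..<b})"
    using integrable by (intro integrable_L2_set) auto
  have "(\<Sum>i<b. integral\<^sup>L M (G i)) = (\<integral>x. (\<Sum>i<b. G i x) \<partial>M)"
    using integrable by (intro Bochner_Integration.integral_sum[symmetric]) auto
  also have "\<dots> \<le> (\<integral>x. L2_set (\<lambda>i. G i x) {..<b} + (\<Sum>j<b. \<Sum>i<j. sqrt (G i x) * sqrt (G j x)) \<partial>M)"
    by (intro integral_mono Bochner_Integration.integrable_add Bochner_Integration.integrable_sum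
        integrable integrable_row integrable_L2 sum_le_L2_set_plus_sqrt_products nonneg) auto
  also have "\<dots> = (\<integral>x. L2_set (\<lambda>i. G i x) {..<b} \<partial>M)
      + (\<integral>x. (\<Sum>j<b. \<Sum>i<j. sqrt (G i x) * sqrt (G j x)) \<partial>M)"
    by (intro Bochner_Integration.integral_add Bochner_Integration.integrable_sum
        integrable_L2 integrable_row) simp
  also have "(\<integral>x. (\<Sum>j<b. \<Sum>i<j. sqrt (G i x) * sqrt (G j x)) \<partial>M)
      = (\<Sum>j<b. \<integral>x. (\<Sum>i<j. sqrt (G i x) * sqrt (G j x)) \<partial>M)"
    by (intro Bochner_Integration.integral_sum integrable_row) simp
  also have "\<dots> = (\<Sum>j<b. \<Sum>i<j. \<integral>x. sqrt (G i x) * sqrt (G j x) \<partial>M)"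
    by (intro sum.cong refl Bochner_Integration.integral_sum integrable_pair) auto
  finally show ?thesis .
qed

lemma sum_power_diff_le:
  fixes q :: real
  assumes "0 \<le> q" and "q < 1"
  shows "(\<Sum>i<j. q ^ (j - i)) \<le> q / (1 - q)"
proof (induction j)
  case 0
  then show ?case using assms by simp
next
  case (Suc j)
  have "(\<Sum>i<Suc j. q ^ (Suc j - i)) = q * (\<Sum>i<j. q ^ (j - i)) + q"
    by (simp add: sum_distrib_left Suc_diff_le)
  also have "\<dots> \<le> q * (q / (1 - q)) + q"
    using Suc assms by (intro add_right_mono mult_left_mono)
  also have "\<dots> = q / (1 - q)"
    using assms by (simp add: field_simps)
  finally show ?case .
qed

lemma integral_L2_set_ge_of_geometric_overlap:
  fixes G :: "nat \<Rightarrow> 'a \<Rightarrow> real" and e q :: real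
  assumes integrable: "\<And>i. i < b \<Longrightarrow> integrable M (G i)" and nonneg: "\<And>i x. G i x \<ge> 0"
    and integral: "\<And>i. i < b \<Longrightarrow> integral\<^sup>L M (G i) = e"
    and pair: "\<And>i j. i < j \<Longrightarrow> j < b \<Longrightarrow> (\<integral>x. sqrt (G i x) * sqrt (G j x) \<partial>M) \<le> K * q ^ (j - i)"
    and "0 \<le> K" and "0 \<le> q" and "q < 1"
  shows "real b * (e - K * q / (1 - q)) \<le> (\<integral>x. L2_set (\<lambda>i. G i x) {..<b} \<partial>M)"
proof -
  have "(\<Sum>j<b. \<Sum>i<j. \<integral>x. sqrt (G i x) * sqrt (G j x) \<partial>M) \<le> (\<Sum>j<b. K * (\<Sum>i<j. q ^ (j - i)))"
    unfolding sum_distrib_left by (intro sum_mono pair) auto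
  also have "\<dots> \<le> (\<Sum>j<b. K * (q / (1 - q)))"
    using assms by (intro sum_mono mult_left_mono sum_power_diff_le)
  finally have "(\<Sum>j<b. \<Sum>i<j. \<integral>x. sqrt (G i x) * sqrt (G j x) \<partial>M) \<le> real b * (K * q / (1 - q))"
    by simp
  moreover have "real b * e \<le> (\<integral>x. L2_set (\<lambda>i. G i x) {..<b} \<partial>M)
      + (\<Sum>j<b. \<Sum>i<j. \<integral>x. sqrt (G i x) * sqrt (G j x) \<partial>M)"
    using sum_integral_le_integral_L2_set[of b M G, OF integrable nonneg] by (simp add: integral)
  ultimately show ?thesis
    by (simp add: right_diff_distrib)
qed

section \<open>Peaked polynomials\<close>

text \<open>The square root of the modulus is the square of a Dirichlet sum, whose rotation means are
  explicit. The modulation makes the polynomial analytic and commutes with the rotation means of any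
  order dividing \<open>L\<close>.\<close>

definition peak :: "nat \<Rightarrow> real \<Rightarrow> complex" where
  "peak L t = cis (2 * real L * t) * of_real ((cmod (dirichlet_sum L t)) ^ 4)"

lemma analytic_trig_poly_peak: "analytic_trig_poly (4 * L) (peak L)"
proof -
  let ?D = "dirichlet_sum L"
  let ?fejer = "\<lambda>t. ?D t * (cis (real L * t) * cnj (?D t))"
  have "?fejer t * ?fejer t = peak L t" for t
  proof -
    have "?fejer t = cis (real L * t) * (?D t * cnj (?D t))"
      by (simp add: mult_ac)
    then have fejer_eq: "?fejer t = cis (real L * t) * of_real ((cmod (?D t))\<^sup>2)"
      by (simp only: complex_norm_square)
    have "?fejer t * ?fejer t = (cis (real L * t) * cis (real L * t)) * of_real ((cmod (?D t)) ^ 4)"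
      unfolding fejer_eq by (simp add: power4_eq_xxxx power2_eq_square mult_ac)
    also have "cis (real L * t) * cis (real L * t) = cis (2 * real L * t)"
      by (simp add: cis_mult mult_ac)
    finally show ?thesis by (simp add: peak_def)
  qed
  moreover have "analytic_trig_poly (L + L + (L + L)) (\<lambda>t. ?fejer t * ?fejer t)"
    by (intro analytic_trig_poly_mult analytic_trig_poly_reflect analytic_trig_poly_dirichlet_sum)
  ultimately have "analytic_trig_poly (L + L + (L + L)) (peak L)" by simp
  then show ?thesis by (rule analytic_trig_poly_mono) simp
qed

lemma norm_peak: "cmod (peak L t) = (cmod (dirichlet_sum L t)) ^ 4"
  by (simp add: peak_def norm_mult norm_power)

definition peak_mean :: "nat \<Rightarrow> nat \<Rightarrow> real \<Rightarrow> real" where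
  "peak_mean L N = rotation_mean N (\<lambda>t. (cmod (dirichlet_sum L t)) ^ 4)"

lemma continuous_on_peak_mean: "continuous_on UNIV (peak_mean L N)"
  unfolding peak_mean_def by (intro continuous_on_rotation_mean continuous_intros)

lemma peak_mean_nonneg: "peak_mean L N t \<ge> 0"
  by (simp add: peak_mean_def rotation_mean_nonneg)

lemma integral_peak_mean:
  "N > 0 \<Longrightarrow> integral\<^sup>L torus (peak_mean L N) = (\<integral>t. (cmod (dirichlet_sum L t)) ^ 4 \<partial>torus)"
  unfolding peak_mean_def
  by (intro integral_rotation_mean continuous_intros) (simp_all add: dirichlet_sum_periodic)

lemma norm_rotation_mean_peak:
  assumes "N dvd L" and "N > 0"
  shows "cmod (rotation_mean N (peak L) t) = peak_mean L N t"
proof -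
  obtain q where L: "L = N * q" using assms by blast
  have "cis (2 * real L * (t + 2 * pi * real j / real N)) = cis (2 * real L * t)" for j
  proof -
    have "cis (2 * real L * (2 * pi * real j / real N)) = cis (2 * pi * real (2 * q * j))"
      using assms by (simp add: L field_simps)
    also have "\<dots> = 1"
      by (rule cis_multiple_2pi) simp
    finally show ?thesis
      by (simp add: distrib_left flip: cis_mult)
  qed
  then have "rotation_mean N (peak L) t = cis (2 * real L * t) * of_real (peak_mean L N t)"
    by (simp add: rotation_mean_def peak_mean_def peak_def scaleR_conv_of_real sum_distrib_left mult_ac)
  then show ?thesis
    by (simp add: norm_mult peak_mean_nonneg)
qed

lemma sqrt_peak_mean_le_rotation_mean:
  "sqrt (peak_mean L N t) \<le> sqrt (real N) * rotation_mean N (\<lambda>t. (cmod (dirichlet_sum L t))\<^sup>2) t"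
  using sqrt_rotation_mean_square_le[of "\<lambda>t. (cmod (dirichlet_sum L t))\<^sup>2" N t]
  by (simp add: peak_mean_def flip: power_mult)

lemma sqrt_peak_mean_le:
  assumes "0 < N" and "N \<le> L"
  shows "sqrt (peak_mean L N t) \<le> 2 * (real L)\<^sup>2 / sqrt (real N)"
proof -
  have "rotation_mean N (\<lambda>t. (cmod (dirichlet_sum L t))\<^sup>2) t \<le> real L * (real L / real N + 1)"
    by (rule rotation_mean_norm_dirichlet_sum_square_le[OF assms(1)])
  also have "\<dots> \<le> real L * (real L / real N + real L / real N)"
    using assms by (intro mult_left_mono add_left_mono) (auto simp: divide_simps)
  finally have "sqrt (real N) * rotation_mean N (\<lambda>t. (cmod (dirichlet_sum L t))\<^sup>2) t
      \<le> sqrt (real N) * (2 * (real L)\<^sup>2 / real N)"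
    by (intro mult_left_mono) (simp_all add: power2_eq_square mult_ac)
  also have "\<dots> = 2 * (real L)\<^sup>2 / sqrt (real N)"
    using assms by (simp add: field_simps)
  finally show ?thesis
    by (rule order_trans[OF sqrt_peak_mean_le_rotation_mean])
qed

lemma integral_sqrt_peak_mean_le:
  assumes "N > 0"
  shows "(\<integral>t. sqrt (peak_mean L N t) \<partial>torus) \<le> sqrt (real N) * real L"
proof -
  let ?h = "\<lambda>t. (cmod (dirichlet_sum L t))\<^sup>2"
  have "(\<integral>t. sqrt (peak_mean L N t) \<partial>torus) \<le> (\<integral>t. sqrt (real N) * rotation_mean N ?h t \<partial>torus)"
    by (intro integral_mono integrable_torus_continuous continuous_intros continuous_on_peak_mean
        continuous_on_rotation_mean sqrt_peak_mean_le_rotation_mean)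
  also have "\<dots> = sqrt (real N) * (\<integral>t. ?h t \<partial>torus)"
    using assms by (simp add: integral_rotation_mean continuous_intros dirichlet_sum_periodic)
  finally show ?thesis
    by (simp add: integral_norm_dirichlet_sum_square)
qed

lemma (in torus_coupling) integral_sqrt_peak_mean_mult_le:
  assumes "i \<in> I" and "0 < M" and "0 < N" and "N \<le> L"
  shows "(\<integral>w. sqrt (peak_mean L M (X i w)) * sqrt (peak_mean L N (X j w)) \<partial>W)
    \<le> 2 * sqrt (real M / real N) * real L ^ 3"
proof -
  have "(\<integral>w. sqrt (peak_mean L M (X i w)) * sqrt (peak_mean L N (X j w)) \<partial>W)
      \<le> 2 * (real L)\<^sup>2 / sqrt (real N) * (\<integral>t. sqrt (peak_mean L M t) \<partial>torus)"
    using assms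
    by (intro integral_mult_coupling_le[where \<phi> = "\<lambda>t. sqrt (peak_mean L M t)"
          and \<psi> = "\<lambda>t. sqrt (peak_mean L N t)"])
      (auto intro!: continuous_intros continuous_on_peak_mean sqrt_peak_mean_le simp: peak_mean_nonneg)
  also have "\<dots> \<le> 2 * (real L)\<^sup>2 / sqrt (real N) * (sqrt (real M) * real L)"
    using assms by (intro mult_left_mono integral_sqrt_peak_mean_le) auto
  also have "\<dots> = 2 * sqrt (real M / real N) * real L ^ 3"
    by (simp add: real_sqrt_divide power2_eq_square power3_eq_cube)
  finally show ?thesis .
qed

lemma sqrt_divide_le_power:
  fixes p x y :: real
  assumes "p > 0" and "y > 0" and "(p ^ m)\<^sup>2 * x \<le> y"
  shows "sqrt (x / y) \<le> (1 / p) ^ m"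
proof (rule real_le_lsqrt)
  show "x / y \<le> ((1 / p) ^ m)\<^sup>2"
    using assms by (simp add: power_divide field_simps)
qed (use assms in simp)

lemma (in torus_coupling) integral_sqrt_peak_mean_mult_le_power:
  assumes "i \<in> I" and "p > 0" and "0 < M" and "0 < N" and "N \<le> L" and growth: "(p ^ m)\<^sup>2 * M \<le> N"
  shows "(\<integral>w. sqrt (peak_mean L M (X i w)) * sqrt (peak_mean L N (X j w)) \<partial>W)
    \<le> 6 * (\<integral>t. (cmod (dirichlet_sum L t)) ^ 4 \<partial>torus) * (1 / real p) ^ m"
proof -
  have "real ((p ^ m)\<^sup>2 * M) \<le> real N"
    using growth by (simp only: of_nat_le_iff)
  then have ratio: "sqrt (real M / real N) \<le> (1 / real p) ^ m"
    using assms by (intro sqrt_divide_le_power) simp_all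
  have "(\<integral>w. sqrt (peak_mean L M (X i w)) * sqrt (peak_mean L N (X j w)) \<partial>W)
      \<le> 2 * sqrt (real M / real N) * real L ^ 3"
    using assms by (intro integral_sqrt_peak_mean_mult_le)
  also have "\<dots> \<le> 2 * (1 / real p) ^ m * (3 * (\<integral>t. (cmod (dirichlet_sum L t)) ^ 4 \<partial>torus))"
    using ratio integral_norm_dirichlet_sum_fourth_ge[of L] by (intro mult_mono) auto
  finally show ?thesis by (simp add: mult_ac)
qed

lemma integral_L2_set_peak_mean_ge:
  fixes K :: "nat \<Rightarrow> nat"
  assumes coupling: "torus_coupling W {..<b} X"
    and K: "\<And>i. i < b \<Longrightarrow> 0 < K i" "\<And>i. i < b \<Longrightarrow> K i \<le> L"
    and growth: "\<And>i j. i < j \<Longrightarrow> j < b \<Longrightarrow> (16 ^ (j - i))\<^sup>2 * K i \<le> K j"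
  shows "real b / 2 * (\<integral>t. (cmod (dirichlet_sum L t)) ^ 4 \<partial>torus)
    \<le> (\<integral>w. L2_set (\<lambda>i. peak_mean L (K i) (X i w)) {..<b} \<partial>W)"
proof -
  interpret torus_coupling W "{..<b}" X by (rule coupling)
  define e where "e = (\<integral>t. (cmod (dirichlet_sum L t)) ^ 4 \<partial>torus)"
  have "e \<ge> 0"
    unfolding e_def by (auto intro!: integral_nonneg_AE)
  have pair: "(\<integral>w. sqrt (peak_mean L (K i) (X i w)) * sqrt (peak_mean L (K j) (X j w)) \<partial>W)
      \<le> 6 * e * (1 / 16) ^ (j - i)" if "i < j" "j < b" for i j
    using integral_sqrt_peak_mean_mult_le_power[of i 16 "K i" "K j" L "j - i" j] that K growth[OF that]
    by (simp add: e_def)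
  have "real b / 2 * e = real b * (e / 2)" by simp
  also have "\<dots> \<le> real b * (e - 6 * e * (1 / 16) / (1 - 1 / 16))"
    using \<open>e \<ge> 0\<close> by (intro mult_left_mono) simp_all
  also have "\<dots> \<le> (\<integral>w. L2_set (\<lambda>i. peak_mean L (K i) (X i w)) {..<b} \<partial>W)"
  proof (rule integral_L2_set_ge_of_geometric_overlap)
    show "integrable W (\<lambda>w. peak_mean L (K i) (X i w))" if "i < b" for i
      using that by (intro integrable_coupling continuous_on_peak_mean) simp
    show "(\<integral>w. peak_mean L (K i) (X i w) \<partial>W) = e" if "i < b" for i
      using that K by (simp add: integral_coupling continuous_on_peak_mean integral_peak_mean e_def)
  qed (use pair \<open>e \<ge> 0\<close> in \<open>simp_all add: peak_mean_nonneg\<close>)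
  finally show ?thesis
    by (simp add: e_def)
qed

definition sparse_peaks :: "nat \<Rightarrow> 'i set \<Rightarrow> 'i \<Rightarrow> real \<Rightarrow> complex" where
  "sparse_peaks L S l = (if l \<in> S then peak L else (\<lambda>_. 0))"

lemma analytic_trig_poly_sparse_peaks:
  assumes "l \<in> S \<Longrightarrow> 4 * L \<le> d"
  shows "analytic_trig_poly d (sparse_peaks L S l)"
  using assms analytic_trig_poly_mono[OF analytic_trig_poly_peak]
  by (simp add: sparse_peaks_def analytic_trig_poly_0)

lemma square_function_sparse_peaks:
  assumes "finite T" and "S \<subseteq> T"
  shows "square_function T (sparse_peaks L S)
    = (\<lambda>t. sqrt (real (card S)) * (cmod (dirichlet_sum L t)) ^ 4)"
proof
  fix t
  have "square_function T (sparse_peaks L S) t = L2_set (\<lambda>l. cmod (sparse_peaks L S l t)) S"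
    unfolding square_function_def using assms by (intro L2_set_mono_neutral) (auto simp: sparse_peaks_def)
  also have "\<dots> = L2_set (\<lambda>_. (cmod (dirichlet_sum L t)) ^ 4) S"
    by (intro L2_set_cong refl) (simp add: sparse_peaks_def norm_peak)
  finally show "square_function T (sparse_peaks L S) t
      = sqrt (real (card S)) * (cmod (dirichlet_sum L t)) ^ 4"
    by (simp add: L2_set_constant)
qed

lemma square_function_cond_exp_sparse_peaks:
  assumes "finite T" and "S \<subseteq> T" and "\<And>l. l \<in> S \<Longrightarrow> N l dvd L" and "\<And>l. l \<in> S \<Longrightarrow> N l > 0"
  shows "square_function T (\<lambda>l w. cond_exp_star (N l) (sparse_peaks L S l) (X l w)) w
    = L2_set (\<lambda>l. peak_mean L (N l) (X l w)) S"
proof -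
  have "square_function T (\<lambda>l w. cond_exp_star (N l) (sparse_peaks L S l) (X l w)) w
      = L2_set (\<lambda>l. cmod (cond_exp_star (N l) (sparse_peaks L S l) (X l w))) S"
    unfolding square_function_def using assms
    by (intro L2_set_mono_neutral) (auto simp: sparse_peaks_def cond_exp_star_def)
  also have "\<dots> = L2_set (\<lambda>l. peak_mean L (N l) (X l w)) S"
    using assms by (intro L2_set_cong refl)
      (simp add: sparse_peaks_def cond_exp_star_eq_rotation_mean norm_rotation_mean_peak)
  finally show ?thesis .
qed

section \<open>The equivalence\<close>

definition square_function_estimate ::
  "'w measure \<Rightarrow> 'i set \<Rightarrow> ('i \<Rightarrow> 'w \<Rightarrow> real) \<Rightarrow> ('i \<Rightarrow> nat) \<Rightarrow> ('i \<Rightarrow> nat) \<Rightarrow> real \<Rightarrow> bool" where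
  "square_function_estimate W I X d N c \<longleftrightarrow>
    (\<forall>f. (\<forall>k\<in>I. analytic_trig_poly (d k) (f k)) \<longrightarrow>
      c * integral\<^sup>L W (square_function I (\<lambda>k w. cond_exp_star (N k) (f k) (X k w)))
        \<le> integral\<^sup>L torus (square_function I f))"

locale divisor_chain =
  fixes N :: "nat \<Rightarrow> nat"
  assumes dvd_Suc: "k \<ge> 1 \<Longrightarrow> N k dvd N (Suc k)" and less_Suc: "k \<ge> 1 \<Longrightarrow> N k < N (Suc k)"
begin

lemma N_pos: "k \<ge> 1 \<Longrightarrow> N k > 0"
  using dvd_Suc[of k] less_Suc[of k] by (cases "N k = 0") auto

lemma N_dvd:
  assumes "1 \<le> k" and "k \<le> l"
  shows "N k dvd N l"
  using assms(2)
proof (induction rule: dec_induct)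
  case (step m)
  then show ?case
    using assms(1) dvd_Suc[of m] by (auto intro: dvd_trans)
qed simp

lemma N_le: "1 \<le> k \<Longrightarrow> k \<le> l \<Longrightarrow> N k \<le> N l"
  using N_dvd N_pos[of l] by (auto intro: dvd_imp_le)

lemma power_mult_N_le:
  assumes "k \<ge> 1"
  shows "2 ^ m * N k \<le> N (k + m)"
proof (induction m)
  case 0
  then show ?case by simp
next
  case (Suc m)
  obtain q where q: "N (Suc (k + m)) = N (k + m) * q"
    using dvd_Suc[of "k + m"] assms by auto
  have "q \<noteq> 0" and "q \<noteq> 1"
    using less_Suc[of "k + m"] assms q by auto
  then have "N (k + m) * 2 \<le> N (Suc (k + m))"
    by (simp add: q)
  then show ?case using Suc by simp
qed

lemma square_function_estimate_of_degree_bound: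
  assumes coupling: "torus_coupling W {1..n} X" and "C \<ge> 0"
    and degree: "\<And>k. k \<ge> 1 \<Longrightarrow> real (d k) \<le> C * real (N (k + a))"
  shows "square_function_estimate W {1..n} X d N (1 / (real (Suc a) * (5 * C + 9)))"
  unfolding square_function_estimate_def cond_exp_star_eq_rotation_mean
proof (intro allI impI)
  define K where "K = real (Suc a) * (5 * C + 9)"
  have "K > 0"
    unfolding K_def using \<open>C \<ge> 0\<close> by (intro mult_pos_pos) auto
  fix f assume f: "\<forall>k\<in>{1..n}. analytic_trig_poly (d k) (f k)"
  have "real (d k) \<le> C * real (N l)" if "k \<ge> 1" "k + Suc a \<le> l" for k l
    using order_trans[OF degree mult_left_mono[OF _ \<open>C \<ge> 0\<close>]] N_le[of "k + a" l] that by simp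
  then have "integral\<^sup>L W (square_function {1..n} (\<lambda>k w. rotation_mean (N k) (f k) (X k w)))
      \<le> K * integral\<^sup>L torus (square_function {1..n} f)"
    unfolding K_def using f N_pos \<open>C \<ge> 0\<close>
    by (intro integral_square_function_rotation_mean_le_separated[OF coupling, where d = d]) auto
  then show "1 / (real (Suc a) * (5 * C + 9))
      * integral\<^sup>L W (square_function {1..n} (\<lambda>k w. rotation_mean (N k) (f k) (X k w)))
    \<le> integral\<^sup>L torus (square_function {1..n} f)"
    using \<open>K > 0\<close> unfolding K_def[symmetric] by (simp add: divide_le_eq mult.commute)
qed

text \<open>Steps of 8 in the chain multiply \<open>N\<close> by at least \<open>16\<^sup>2\<close>; the pair correlations then sum to at
  most \<open>6 / 15\<close> of the total mass, leaving more than half of it.\<close>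

lemma integral_cond_exp_sparse_peaks_ge:
  assumes coupling: "torus_coupling W {1..n} X" and "k \<ge> 1" and n: "n = k + 8 * b"
  shows "real b / 2 * (\<integral>t. (cmod (dirichlet_sum (N n) t)) ^ 4 \<partial>torus)
    \<le> integral\<^sup>L W (square_function {1..n}
        (\<lambda>l w. cond_exp_star (N l) (sparse_peaks (N n) ((\<lambda>i. k + 8 * i) ` {..<b}) l) (X l w)))"
proof -
  define \<sigma> where "\<sigma> i = k + 8 * i" for i
  have range: "\<sigma> i \<ge> 1" "\<sigma> i \<le> n" if "i < b" for i
    using that \<open>k \<ge> 1\<close> by (auto simp: \<sigma>_def n)
  have "(16 ^ (j - i))\<^sup>2 * N (\<sigma> i) \<le> N (\<sigma> j)" if "i < j" for i j
  proof -
    have "2 ^ (8 * (j - i)) * N (\<sigma> i) \<le> N (\<sigma> i + 8 * (j - i))"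
      using \<open>k \<ge> 1\<close> by (intro power_mult_N_le) (simp add: \<sigma>_def)
    moreover have "\<sigma> i + 8 * (j - i) = \<sigma> j"
      using that by (simp add: \<sigma>_def)
    ultimately show ?thesis
      by (simp add: power_mult power2_eq_square flip: power_mult_distrib)
  qed
  moreover have "torus_coupling W {..<b} (\<lambda>i. X (\<sigma> i))"
    using range by (intro torus_coupling_reindex[OF coupling]) auto
  ultimately have "real b / 2 * (\<integral>t. (cmod (dirichlet_sum (N n) t)) ^ 4 \<partial>torus)
      \<le> (\<integral>w. L2_set (\<lambda>i. peak_mean (N n) (N (\<sigma> i)) (X (\<sigma> i) w)) {..<b} \<partial>W)"
    using range N_pos N_le by (intro integral_L2_set_peak_mean_ge) auto
  also have "\<dots> = (\<integral>w. L2_set (\<lambda>l. peak_mean (N n) (N l) (X l w)) (\<sigma> ` {..<b}) \<partial>W)"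
    unfolding L2_set_def by (subst sum.reindex) (auto simp: inj_on_def \<sigma>_def)
  also have "\<dots> = integral\<^sup>L W (square_function {1..n}
      (\<lambda>l w. cond_exp_star (N l) (sparse_peaks (N n) (\<sigma> ` {..<b}) l) (X l w)))"
    using range N_pos N_dvd
    by (intro Bochner_Integration.integral_cong refl
        square_function_cond_exp_sparse_peaks[symmetric]) auto
  finally show ?thesis
    by (simp add: \<sigma>_def)
qed

lemma square_function_estimate_constant_le:
  assumes coupling: "torus_coupling W {1..n} X" and "k \<ge> 1" and n: "n = k + 8 * b"
    and degree: "\<And>l. l \<ge> k \<Longrightarrow> 4 * N n \<le> d l"
    and estimate: "square_function_estimate W {1..n} X d N c" and "c \<ge> 0"
  shows "c * sqrt (real b) \<le> 2"
proof -
  define S where "S = (\<lambda>i. k + 8 * i) ` {..<b}"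
  define e where "e = (\<integral>t. (cmod (dirichlet_sum (N n) t)) ^ 4 \<partial>torus)"
  have S: "card S = b" "S \<subseteq> {1..n}" "\<And>l. l \<in> S \<Longrightarrow> k \<le> l"
    using \<open>k \<ge> 1\<close> by (auto simp: S_def n card_image inj_on_def)
  have "0 < real (N n) ^ 3"
    using N_pos[of n] \<open>k \<ge> 1\<close> n by simp
  also have "\<dots> \<le> 3 * e"
    unfolding e_def by (rule integral_norm_dirichlet_sum_fourth_ge)
  finally have "e > 0" by simp
  have "c * (real b / 2 * e) \<le> c * integral\<^sup>L W (square_function {1..n}
      (\<lambda>l w. cond_exp_star (N l) (sparse_peaks (N n) S l) (X l w)))"
    unfolding S_def e_def using \<open>c \<ge> 0\<close> integral_cond_exp_sparse_peaks_ge[OF coupling \<open>k \<ge> 1\<close> n]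
    by (rule mult_left_mono[rotated])
  also have "\<dots> \<le> integral\<^sup>L torus (square_function {1..n} (sparse_peaks (N n) S))"
    using estimate degree S(3)
    by (auto simp: square_function_estimate_def intro!: analytic_trig_poly_sparse_peaks)
  also have "\<dots> = sqrt (real b) * e"
    unfolding square_function_sparse_peaks[OF finite_atLeastAtMost S(2)] S(1) by (simp add: e_def)
  finally have "(c * sqrt (real b) * sqrt (real b)) * e \<le> (2 * sqrt (real b)) * e"
    by (simp add: mult_ac)
  then show ?thesis
    using \<open>e > 0\<close> by (cases "b = 0") (simp_all add: mult_le_cancel_right_pos)
qed

lemma degree_bound_of_square_function_estimate:
  assumes coupling: "\<And>n. torus_coupling (W n) {1..n} (X n)"
    and mono: "\<And>k l. 1 \<le> k \<Longrightarrow> k \<le> l \<Longrightarrow> d k \<le> d l"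
    and estimate: "\<And>n. square_function_estimate (W n) {1..n} (X n) d N c" and "c > 0"
  shows "\<exists>a C. \<forall>k\<ge>1. real (d k) \<le> C * real (N (k + a))"
proof -
  obtain m :: nat where "real m > 2 / c"
    using reals_Archimedean2 by blast
  then have large: "c * sqrt (real (m\<^sup>2)) > 2"
    using \<open>c > 0\<close> by (simp add: field_simps)
  have "real (d k) \<le> 4 * real (N (k + 8 * m\<^sup>2))" if "k \<ge> 1" for k
  proof (rule ccontr)
    assume "\<not> ?thesis"
    then have "4 * N (k + 8 * m\<^sup>2) \<le> d l" if "l \<ge> k" for l
      using mono[OF \<open>k \<ge> 1\<close> that] by linarith
    then have "c * sqrt (real (m\<^sup>2)) \<le> 2"
      using \<open>c > 0\<close>
      by (intro square_function_estimate_constant_le[OF coupling \<open>k \<ge> 1\<close> refl _ estimate]) auto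
    with large show False by simp
  qed
  then show ?thesis by blast
qed

lemma degree_bound_iff_square_function_estimate:
  assumes coupling: "\<And>n. torus_coupling (W n) {1..n} (X n)"
    and mono: "\<And>k l. 1 \<le> k \<Longrightarrow> k \<le> l \<Longrightarrow> d k \<le> d l"
  shows "(\<exists>a C. \<forall>k\<ge>1. real (d k) \<le> C * real (N (k + a)))
    \<longleftrightarrow> (\<exists>c>0. \<forall>n. square_function_estimate (W n) {1..n} (X n) d N c)"
proof
  assume "\<exists>a C. \<forall>k\<ge>1. real (d k) \<le> C * real (N (k + a))"
  then obtain a C where "\<And>k. k \<ge> 1 \<Longrightarrow> real (d k) \<le> C * real (N (k + a))" by blast
  then have "real (d k) \<le> \<bar>C\<bar> * real (N (k + a))" if "k \<ge> 1" for k
    using that by (meson abs_ge_self mult_right_mono of_nat_0_le_iff order_trans)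
  then have "square_function_estimate (W n) {1..n} (X n) d N (1 / (real (Suc a) * (5 * \<bar>C\<bar> + 9)))" for n
    by (intro square_function_estimate_of_degree_bound coupling) auto
  moreover have "1 / (real (Suc a) * (5 * \<bar>C\<bar> + 9)) > 0"
    by (intro divide_pos_pos mult_pos_pos) auto
  ultimately show "\<exists>c>0. \<forall>n. square_function_estimate (W n) {1..n} (X n) d N c" by blast
qed (use degree_bound_of_square_function_estimate[of W X d, OF coupling mono] in blast)

end

lemma lacunary_mono:
  assumes "lacunary d" and "1 \<le> k" and "k \<le> l"
  shows "d k \<le> d l"
  using assms(3)
proof (induction rule: dec_induct)
  case (step m)
  obtain q where "q > 1" and q: "\<And>k. k \<ge> 1 \<Longrightarrow> q * real (d k) \<le> real (d (Suc k))"
    using \<open>lacunary d\<close> by (auto simp: lacunary_def)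
  have "real (d m) \<le> q * real (d m)"
    using \<open>q > 1\<close> by (simp add: mult_le_cancel_right1)
  also have "\<dots> \<le> real (d (Suc m))"
    using step assms(2) by (intro q) simp
  finally show ?case
    using step by simp
qed simp

theorem theorem2p3:
  fixes d N :: "nat \<Rightarrow> nat"
  assumes dpos: "\<forall>k\<ge>1. d k > 0"
    and lac: "lacunary d"
    and Ndvd: "\<forall>k\<ge>1. N k dvd N (Suc k)"
    and Nless: "\<forall>k\<ge>1. N k < N (Suc k)"
  shows "((\<exists>(a::nat) (C::real). \<forall>k\<ge>1. real (d k) \<le> C * real (N (k + a)))
        \<longleftrightarrow>
         (\<exists>c>0. \<forall>n. \<forall>f :: nat \<Rightarrow> real \<Rightarrow> complex.
            (\<forall>k\<in>{1..n}. analytic_trig_poly (d k) (f k)) \<longrightarrow>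
            torus_expect (\<lambda>t. sqrt (\<Sum>k\<in>{1..n}. (cmod (f k t))\<^sup>2))
              \<ge> c * torus_expect (\<lambda>t. sqrt (\<Sum>k\<in>{1..n}. (cmod (cond_exp_star (N k) (f k) t))\<^sup>2))))
       \<and>
       ((\<exists>(a::nat) (C::real). \<forall>k\<ge>1. real (d k) \<le> C * real (N (k + a)))
        \<longleftrightarrow>
         (\<exists>c>0. \<forall>n. \<forall>f :: nat \<Rightarrow> real \<Rightarrow> complex.
            (\<forall>k\<in>{1..n}. analytic_trig_poly (d k) (f k)) \<longrightarrow>
            L1_l2_norm n f \<ge> c * ind_norm n (\<lambda>k. cond_exp_star (N k) (f k))))"
proof -
  interpret divisor_chain N
    using Ndvd Nless by unfold_locales auto
  note iff_estimate = degree_bound_iff_square_function_estimate[OF _ lacunary_mono[OF lac]]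
  show ?thesis
    using iff_estimate[of "\<lambda>_. torus" "\<lambda>_ _ t. t", OF torus_coupling_identity]
      iff_estimate[of "\<lambda>n. PiM {1..n} (\<lambda>_. torus)" "\<lambda>_ k x. x k", OF torus_coupling_product]
    by (simp only: square_function_estimate_def square_function_def[abs_def] L2_set_def
        torus_expect_def L1_l2_norm_def ind_norm_def)
qed

end
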